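(* Any complete $+$isotropic surface in the flat Minkowski space $\mathbb{R}^4_1$ is isometric to the Euclidean plane $\mathbb{R}^2$, and, up to an isometry of $\mathbb{R}^4_1$, a $+$isotropic surface in $\mathbb{R}^4_1$ has (locally) the form $$i_\lambda:\mathbb{R}^2\to\mathbb{R}^4_1,\qquad (z_1,z_2)\mapsto(\lambda(z_1,z_2),\lambda(z_1,z_2),z_1,z_2),$$ where $\lambda$ is a smooth function on $\mathbb{R}^2$.
   Context: $\mathbb{R}^4_1$ is $\mathbb{R}^4$ with its standard orientation and the metric $-dx_1^2+dx_2^2+dx_3^2+dx_4^2$. Surfaces are oriented, immersed and spacelike (the induced metric is positive definite); completeness refers to the induced Riemannian metric. For an oriented spacelike immersed surface $N^2$ in an oriented Lorentzian 4-manifold $(M,g)$, take a local Darboux frame $e=(e_1,\dots,e_4)$: positively oriented in $M$, pseudo-orthonormal with $g(e_1,e_1)=-1$, and $(e_3,e_4)$ a positively oriented orthonormal frame of $TN$. The normal bundle splits into null line bundles $TN^\perp=TN_+^\perp\oplus TN_-^\perp$, $TN^\perp_\pm=\mathbb{R}(e_1\pm e_2)$. The surface is $+$isotropic if its second fundamental form takes values in $TN_+^\perp$, i.e. $II(V,W)\in TN^\perp_+$ for all tangent $V,W$. *)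

theory Defs
  imports "HOL-Analysis.Analysis"
begin

section \<open>Smooth maps on open subsets of Euclidean spaces\<close>

text \<open>Directional derivatives in all directions, iterated. On an open set \<open>S\<close> of a
  finite-dimensional space this is the usual notion of a \<open>C\<^sup>k\<close> map.\<close>

primrec Ck_on :: "nat \<Rightarrow> ('a::euclidean_space \<Rightarrow> 'b::euclidean_space) \<Rightarrow> 'a set \<Rightarrow> bool" where
  "Ck_on 0 f S \<longleftrightarrow> continuous_on S f"
| "Ck_on (Suc k) f S \<longleftrightarrow>
     (\<forall>x\<in>S. f differentiable (at x)) \<and>
     (\<forall>v. Ck_on k (\<lambda>x. frechet_derivative f (at x) v) S)"

definition smooth_on :: "'a::euclidean_space set \<Rightarrow> ('a \<Rightarrow> 'b::euclidean_space) \<Rightarrow> bool" where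
  "smooth_on S f \<longleftrightarrow> open S \<and> (\<forall>k. Ck_on k f S)"


section \<open>Minkowski space\<close>

definition mink :: "real^4 \<Rightarrow> real^4 \<Rightarrow> real" where
  "mink x y = - (x$1 * y$1) + x$2 * y$2 + x$3 * y$3 + x$4 * y$4"

definition mink_isometry :: "(real^4 \<Rightarrow> real^4) \<Rightarrow> bool" where
  "mink_isometry \<Phi> \<longleftrightarrow>
     bij \<Phi> \<and> smooth_on UNIV \<Phi> \<and> smooth_on UNIV (inv \<Phi>) \<and>
     (\<forall>p v w. mink (frechet_derivative \<Phi> (at p) v) (frechet_derivative \<Phi> (at p) w) = mink v w)"


section \<open>Oriented surfaces\<close>

text \<open>A surface is a type \<open>'a\<close> (Hausdorff, second countable) together with an oriented smooth
  atlas. A chart is a pair of its domain and the coordinate map, whose values outside the domain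
  are irrelevant.\<close>

type_synonym 'a chart = "'a set \<times> ('a \<Rightarrow> real^2)"

abbreviation chart_image :: "'a chart \<Rightarrow> (real^2) set" where
  "chart_image c \<equiv> snd c ` fst c"

abbreviation chart_inv :: "'a chart \<Rightarrow> real^2 \<Rightarrow> 'a" where
  "chart_inv c \<equiv> inv_into (fst c) (snd c)"

definition is_chart :: "'a::topological_space chart \<Rightarrow> bool" where
  "is_chart c \<longleftrightarrow> open (fst c) \<and> open (chart_image c) \<and>
     homeomorphism (fst c) (chart_image c) (snd c) (chart_inv c)"

definition oriented_transition :: "'a chart \<Rightarrow> 'a chart \<Rightarrow> bool" where
  "oriented_transition c d \<longleftrightarrow>
     (let D = snd c ` (fst c \<inter> fst d); \<tau> = snd d \<circ> chart_inv c in
        smooth_on D \<tau> \<and> (\<forall>u\<in>D. det (matrix (frechet_derivative \<tau> (at u))) > 0))"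

definition oriented_atlas :: "'a::topological_space chart set \<Rightarrow> bool" where
  "oriented_atlas A \<longleftrightarrow>
     (\<forall>c\<in>A. is_chart c) \<and> (\<Union>c\<in>A. fst c) = UNIV \<and> (\<forall>c\<in>A. \<forall>d\<in>A. oriented_transition c d)"

text \<open>The charts of the maximal oriented atlas determined by \<open>A\<close>.\<close>

definition oriented_chart :: "'a::topological_space chart set \<Rightarrow> 'a chart \<Rightarrow> bool" where
  "oriented_chart A c \<longleftrightarrow>
     is_chart c \<and> (\<forall>d\<in>A. oriented_transition c d \<and> oriented_transition d c)"


section \<open>Spacelike immersions and the induced metric\<close>

text \<open>All pointwise objects are written at the point with coordinates \<open>u\<close> in the chart \<open>c\<close>;
  tangent vectors of the surface are given by their components in \<open>\<real>\<^sup>2\<close> with respect to \<open>c\<close>.\<close>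

definition local_rep :: "('a \<Rightarrow> 'b) \<Rightarrow> 'a chart \<Rightarrow> real^2 \<Rightarrow> 'b" where
  "local_rep f c = f \<circ> chart_inv c"

definition differential :: "('a \<Rightarrow> 'b::euclidean_space) \<Rightarrow> 'a chart \<Rightarrow> real^2 \<Rightarrow> real^2 \<Rightarrow> 'b" where
  "differential f c u = frechet_derivative (local_rep f c) (at u)"

definition induced_metric :: "('a \<Rightarrow> real^4) \<Rightarrow> 'a chart \<Rightarrow> real^2 \<Rightarrow> real^2 \<Rightarrow> real^2 \<Rightarrow> real" where
  "induced_metric f c u v w = mink (differential f c u v) (differential f c u w)"

definition spacelike_immersion :: "'a chart set \<Rightarrow> ('a \<Rightarrow> real^4) \<Rightarrow> bool" where
  "spacelike_immersion A f \<longleftrightarrow>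
     (\<forall>c\<in>A. smooth_on (chart_image c) (local_rep f c) \<and>
        (\<forall>u\<in>chart_image c. inj (differential f c u) \<and>
           (\<forall>v. v \<noteq> 0 \<longrightarrow> induced_metric f c u v v > 0)))"


section \<open>Second fundamental form and isotropy\<close>

definition normal_part :: "(real^4) set \<Rightarrow> real^4 \<Rightarrow> real^4" where
  "normal_part T y = (THE n. (\<forall>t\<in>T. mink n t = 0) \<and> y - n \<in> T)"

text \<open>The ambient connection is the flat one, so for the coordinate (constant component) vector
  fields \<open>V\<close> and \<open>W\<close> the vector \<open>\<nabla>\<^sub>V W\<close> is the second derivative of the local
  representation.\<close>

definition second_fundamental_form ::
    "('a \<Rightarrow> real^4) \<Rightarrow> 'a chart \<Rightarrow> real^2 \<Rightarrow> real^2 \<Rightarrow> real^2 \<Rightarrow> real^4" where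
  "second_fundamental_form f c u v w =
     normal_part (range (differential f c u))
       (frechet_derivative (\<lambda>u'. differential f c u' w) (at u) v)"

text \<open>The rows of \<open>e\<close> are the frame vectors \<open>e\<^sub>1, \<dots>, e\<^sub>4\<close>. The chart \<open>c\<close> belongs to an oriented
  atlas, so a tangent frame is positive iff its components in \<open>c\<close> have positive determinant.\<close>

definition darboux_frame :: "('a \<Rightarrow> real^4) \<Rightarrow> 'a chart \<Rightarrow> real^2 \<Rightarrow> real^4^4 \<Rightarrow> bool" where
  "darboux_frame f c u e \<longleftrightarrow>
     det e > 0 \<and>
     (\<forall>i j. mink (e$i) (e$j) = (if i = j then (if i = 1 then -1 else 1) else 0)) \<and>
     (\<exists>a b. e$3 = differential f c u a \<and> e$4 = differential f c u b \<and>
            det (vector [a, b] :: real^2^2) > 0)"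

text \<open>The line \<open>\<real>(e\<^sub>1 + e\<^sub>2)\<close>; it is the same for all Darboux frames at a point.\<close>

definition plus_null_normal :: "('a \<Rightarrow> real^4) \<Rightarrow> 'a chart \<Rightarrow> real^2 \<Rightarrow> (real^4) set" where
  "plus_null_normal f c u = {s *\<^sub>R (e$1 + e$2) |s e. darboux_frame f c u e}"

definition plus_isotropic :: "'a chart set \<Rightarrow> ('a \<Rightarrow> real^4) \<Rightarrow> bool" where
  "plus_isotropic A f \<longleftrightarrow>
     (\<forall>c\<in>A. \<forall>u\<in>chart_image c. \<forall>v w.
        second_fundamental_form f c u v w \<in> plus_null_normal f c u)"


section \<open>Completeness of the induced metric\<close>

definition piecewise_C1_curve :: "'a::topological_space chart set \<Rightarrow> (real \<Rightarrow> 'a) \<Rightarrow> bool" where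
  "piecewise_C1_curve A \<gamma> \<longleftrightarrow>
     path \<gamma> \<and>
     (\<exists>F. finite F \<and>
        (\<forall>c\<in>A. (snd c \<circ> \<gamma>) C1_differentiable_on {t \<in> {0<..<1} - F. \<gamma> t \<in> fst c}))"

text \<open>The speed of \<open>\<gamma>\<close> in the induced metric is the Minkowski norm of the (spacelike) velocity
  of \<open>f \<circ> \<gamma>\<close>. Using \<open>has_integral\<close> as a relation restricts to curves of finite length.\<close>

definition has_length :: "('a \<Rightarrow> real^4) \<Rightarrow> (real \<Rightarrow> 'a) \<Rightarrow> real \<Rightarrow> bool" where
  "has_length f \<gamma> L \<longleftrightarrow>
     ((\<lambda>t. let v = vector_derivative (f \<circ> \<gamma>) (at t) in sqrt (mink v v)) has_integral L) {0..1}"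

text \<open>On a connected surface the set of lengths is never empty.\<close>

definition riemannian_dist ::
    "'a::topological_space chart set \<Rightarrow> ('a \<Rightarrow> real^4) \<Rightarrow> 'a \<Rightarrow> 'a \<Rightarrow> real" where
  "riemannian_dist A f p q =
     Inf {L. \<exists>\<gamma>. piecewise_C1_curve A \<gamma> \<and> pathstart \<gamma> = p \<and> pathfinish \<gamma> = q \<and> has_length f \<gamma> L}"

definition complete_surface :: "'a::topological_space chart set \<Rightarrow> ('a \<Rightarrow> real^4) \<Rightarrow> bool" where
  "complete_surface A f \<longleftrightarrow>
     (\<forall>s :: nat \<Rightarrow> 'a.
        (\<forall>\<epsilon>>0. \<exists>M. \<forall>m\<ge>M. \<forall>n\<ge>M. riemannian_dist A f (s m) (s n) < \<epsilon>) \<longrightarrow>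
        (\<exists>p. (\<lambda>n. riemannian_dist A f (s n) p) \<longlonglongrightarrow> 0))"


section \<open>The Euclidean plane and the model surfaces\<close>

definition isometric_to_plane :: "'a::topological_space chart set \<Rightarrow> ('a \<Rightarrow> real^4) \<Rightarrow> bool" where
  "isometric_to_plane A f \<longleftrightarrow>
     (\<exists>(\<Psi> :: 'a \<Rightarrow> real^2) \<Psi>'.
        homeomorphism UNIV UNIV \<Psi> \<Psi>' \<and>
        (\<forall>c\<in>A. smooth_on (chart_image c) (local_rep \<Psi> c) \<and>
               smooth_on (\<Psi> ` fst c) (snd c \<circ> \<Psi>') \<and>
               (\<forall>u\<in>chart_image c. \<forall>v w.
                  differential \<Psi> c u v \<bullet> differential \<Psi> c u w = induced_metric f c u v w)))"

definition i_lambda :: "(real^2 \<Rightarrow> real) \<Rightarrow> real^2 \<Rightarrow> real^4" where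
  "i_lambda l z = vector [l z, l z, z$1, z$2]"

end

theory Submission
  imports Defs
begin

text \<open>
  The surface is a graph over a plane because its null normal direction does not move. Let
  \<open>n = (1, \<nu>)\<close> be the vector of \<open>TN\<^sub>+\<close> with time component \<open>1\<close>; then \<open>\<nu>\<close> is a unit vector of
  \<open>\<real>\<^sup>3\<close>. The second fundamental form is a multiple of the null vector \<open>n\<close>, hence orthogonal to \<open>n\<close>,
  and so \<open>n\<close> is orthogonal to all second derivatives of the immersion. Differentiating
  \<open>\<langle>n, df w\<rangle> = 0\<close> and \<open>\<langle>n, n\<rangle> = 0\<close> then shows that \<open>dn\<close> is orthogonal to the tangent plane and to
  \<open>n\<close>. A vector with these properties is a multiple of \<open>n\<close>, and its time component is \<open>0\<close>, so
  \<open>dn = 0\<close> (\<open>chart_null_dir_derivative_zero\<close>).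

  This argument needs \<open>n\<close> to be differentiable, and here the orientation enters. For a
  positive basis \<open>a, b\<close> of the tangent plane with spatial parts \<open>a', b'\<close>, the plus null direction is
  the one of the two null normals for which \<open>\<nu> \<bullet> (a' \<times> b') > 0\<close>
  (\<open>darboux_frame_plus_null_dir\<close>). Then \<open>\<nu> \<bullet> (a' \<times> b')\<close> is the positive square root of the Gram
  determinant, and \<open>\<nu>\<close> is the solution of a linear system with differentiable coefficients
  (\<open>plus_null_dir_eq\<close>).

  On a connected surface \<open>\<nu>\<close> is therefore constant. A rotation of space takes it to the first axis
  and a translation makes the first two coordinates of the immersion agree; call them \<open>lam\<close>, and
  call the map given by the last two coordinates \<open>g\<close> (\<open>isotropic_graph_form\<close>). Since the first two
  coordinates cancel in the Minkowski form, \<open>g\<close> is a local isometry into the Euclidean plane, and it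
  preserves the orientation. Restrictions of \<open>g\<close> to small open sets are the charts in which the
  surface has the form \<open>i\<^sub>\<lambda>\<close>; the function \<open>lam \<circ> g\<inverse>\<close>, known only on a disc, is extended to the
  plane with a smooth cutoff (\<open>local_graph_chart\<close>).

  If the surface is complete, \<open>g\<close> is a bijection. The length of a curve is the Euclidean
  length of its image under \<open>g\<close>, so lifting a segment step by step produces Cauchy sequences, and
  their limits allow the lift to continue. Hence a local inverse of \<open>g\<close> extends along every segment
  that starts at its base point (\<open>section_reaches_everywhere\<close>). The extensions fit together to a
  continuous section of \<open>g\<close> on the whole plane, whose image is open and closed and thus the whole
  surface (\<open>complete_imp_homeomorphism\<close>).
\<close>

section \<open>Calculus of \<open>C\<^sup>k\<close> maps\<close>

lemma Ck_on_subset: "Ck_on k f S \<Longrightarrow> T \<subseteq> S \<Longrightarrow> Ck_on k f T"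
  by (induction k arbitrary: f) (auto intro: continuous_on_subset)

lemma Ck_on_cong:
  assumes "open S" "\<And>x. x \<in> S \<Longrightarrow> f x = g x"
  shows "Ck_on k f S \<Longrightarrow> Ck_on k g S"
  using assms(2)
proof (induction k arbitrary: f g)
  case 0
  then show ?case by (simp cong: continuous_on_cong)
next
  case (Suc k)
  have d: "f differentiable at x" if "x \<in> S" for x using Suc.prems that by simp
  have gd: "(g has_derivative frechet_derivative f (at x)) (at x)" if "x \<in> S" for x
    using has_derivative_transform_within_open[OF frechet_derivative_works[THEN iffD1, OF d[OF that]] assms(1) that]
      Suc.prems by simp
  then have e: "frechet_derivative f (at x) = frechet_derivative g (at x)" if "x \<in> S" for x
    using that frechet_derivative_at by blast
  have "Ck_on k (\<lambda>x. frechet_derivative g (at x) v) S" for v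
    by (rule Suc.IH[of "\<lambda>x. frechet_derivative f (at x) v"]) (use Suc.prems e in auto)
  then show ?case using gd by (auto simp: differentiable_def)
qed

text \<open>Being \<open>C\<^sup>k\<close> is a local property because it is defined by values of
  iterated derivatives at points.\<close>

lemma Ck_on_local:
  assumes "\<And>x. x \<in> S \<Longrightarrow> \<exists>T. open T \<and> x \<in> T \<and> Ck_on k f T"
  shows "Ck_on k f S"
  using assms
proof (induction k arbitrary: f)
  case 0
  have "isCont f x" if "x \<in> S" for x
    using 0[OF that] continuous_on_eq_continuous_at by auto
  then show ?case by (simp add: continuous_at_imp_continuous_on)
next
  case (Suc k)
  have "Ck_on k (\<lambda>x. frechet_derivative f (at x) v) S" for v
    by (rule Suc.IH) (use Suc.prems in fastforce)
  then show ?case using Suc.prems by fastforce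
qed

lemma Ck_on_SucD: "Ck_on (Suc k) f S \<Longrightarrow> Ck_on k f S"
proof (induction k arbitrary: f)
  case 0
  then show ?case
    by (auto intro!: continuous_at_imp_continuous_on differentiable_imp_continuous_within)
next
  case (Suc k)
  have "Ck_on k (\<lambda>x. frechet_derivative f (at x) v) S" for v
    by (rule Suc.IH) (use Suc.prems in auto)
  then show ?case using Suc.prems by simp
qed

lemma Ck_on_has_derivative:
  assumes "Ck_on (Suc k) f S" "x \<in> S"
  shows "(f has_derivative frechet_derivative f (at x)) (at x)"
  using assms by (auto simp: frechet_derivative_works)

text \<open>The form in which regularity is proved by induction on \<open>k\<close>: the
  derivative only has to be built from maps that are already known to be
  \<open>C\<^sup>k\<close>.\<close>

lemma Ck_on_SucI:
  assumes "open S" "\<And>x. x \<in> S \<Longrightarrow> (f has_derivative f' x) (at x)"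
    and "\<And>v. Ck_on k (\<lambda>x. f' x v) S"
  shows "Ck_on (Suc k) f S"
proof -
  have e: "frechet_derivative f (at x) = f' x" if "x \<in> S" for x
    using assms(2)[OF that] frechet_derivative_at by metis
  have "Ck_on k (\<lambda>x. frechet_derivative f (at x) v) S" for v
    by (rule Ck_on_cong[OF assms(1) _ assms(3)[of v]]) (simp add: e)
  then show ?thesis using assms(2) by (auto simp: differentiable_def)
qed

lemma Ck_on_const: "open S \<Longrightarrow> Ck_on k (\<lambda>x. c) S"
proof (induction k arbitrary: c)
  case (Suc k)
  then show ?case by (intro Ck_on_SucI[where f' = "\<lambda>x v. 0"]) auto
qed auto

lemma Ck_on_bounded_linear_comp:
  assumes "bounded_linear L" "open S"
  shows "Ck_on k f S \<Longrightarrow> Ck_on k (\<lambda>x. L (f x)) S"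
proof (induction k arbitrary: f)
  case 0
  then show ?case using bounded_linear.continuous_on[OF assms(1)] by auto
next
  case (Suc k)
  show ?case
  proof (rule Ck_on_SucI[OF assms(2)])
    show "((\<lambda>x. L (f x)) has_derivative (\<lambda>v. L (frechet_derivative f (at x) v))) (at x)" if "x \<in> S" for x
      by (rule bounded_linear.has_derivative[OF assms(1) Ck_on_has_derivative[OF Suc.prems that]])
    show "Ck_on k (\<lambda>x. L (frechet_derivative f (at x) v)) S" for v
      using Suc.IH Suc.prems by auto
  qed
qed

lemma Ck_on_linear:
  assumes "bounded_linear L" "open S"
  shows "Ck_on k L S"
proof (cases k)
  case 0
  then show ?thesis using assms by (simp add: linear_continuous_on)
next
  case (Suc m)
  show ?thesis unfolding Suc
    by (rule Ck_on_SucI[where f' = "\<lambda>x. L"])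
      (use assms in \<open>auto intro: bounded_linear_imp_has_derivative Ck_on_const\<close>)
qed

lemma Ck_on_add:
  assumes "open S"
  shows "Ck_on k f S \<Longrightarrow> Ck_on k g S \<Longrightarrow> Ck_on k (\<lambda>x. f x + g x) S"
proof (induction k arbitrary: f g)
  case 0
  then show ?case by (auto intro: continuous_intros)
next
  case (Suc k)
  show ?case
  proof (rule Ck_on_SucI[OF assms])
    show "((\<lambda>x. f x + g x) has_derivative
        (\<lambda>v. frechet_derivative f (at x) v + frechet_derivative g (at x) v)) (at x)" if "x \<in> S" for x
      by (intro has_derivative_add Ck_on_has_derivative[OF _ that]) (use Suc.prems in blast)+
  qed (use Suc in auto)
qed

lemma Ck_on_sum:
  assumes "open S"
  shows "(\<And>i. i \<in> I \<Longrightarrow> Ck_on k (f i) S) \<Longrightarrow> Ck_on k (\<lambda>x. \<Sum>i\<in>I. f i x) S"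
  by (induction I rule: infinite_finite_induct) (auto intro: Ck_on_const Ck_on_add assms)

lemma Ck_on_bilinear:
  assumes "bounded_bilinear B" "open S"
  shows "Ck_on k f S \<Longrightarrow> Ck_on k g S \<Longrightarrow> Ck_on k (\<lambda>x. B (f x) (g x)) S"
proof (induction k arbitrary: f g)
  case 0
  then show ?case using bounded_bilinear.continuous_on[OF assms(1)] by auto
next
  case (Suc k)
  show ?case
  proof (rule Ck_on_SucI[OF assms(2)])
    show "((\<lambda>x. B (f x) (g x)) has_derivative
        (\<lambda>v. B (f x) (frechet_derivative g (at x) v) + B (frechet_derivative f (at x) v) (g x))) (at x)"
      if "x \<in> S" for x
      by (intro bounded_bilinear.FDERIV[OF assms(1)] Ck_on_has_derivative[OF _ that]) (use Suc.prems in blast)+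
    show "Ck_on k (\<lambda>x. B (f x) (frechet_derivative g (at x) v) + B (frechet_derivative f (at x) v) (g x)) S" for v
      using Suc.prems Suc.prems[THEN Ck_on_SucD] by (intro Ck_on_add[OF assms(2)] Suc.IH) auto
  qed
qed

lemmas Ck_on_mult = Ck_on_bilinear[OF bounded_bilinear_mult]
lemmas Ck_on_scaleR = Ck_on_bilinear[OF bounded_bilinear_scaleR]

lemma Ck_on_minus: "open S \<Longrightarrow> Ck_on k f S \<Longrightarrow> Ck_on k (\<lambda>x. - f x) S"
  by (rule Ck_on_bounded_linear_comp[OF bounded_linear_minus[OF bounded_linear_ident]])

lemma Ck_on_diff: "open S \<Longrightarrow> Ck_on k f S \<Longrightarrow> Ck_on k g S \<Longrightarrow> Ck_on k (\<lambda>x. f x - g x) S"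
  using Ck_on_add[of S k f "\<lambda>x. - g x"] Ck_on_minus by auto

lemma Ck_on_nth: "open S \<Longrightarrow> Ck_on k f S \<Longrightarrow> Ck_on k (\<lambda>x. f x $ i) S"
  by (rule Ck_on_bounded_linear_comp[OF bounded_linear_vec_nth])

text \<open>The chain rule is written in an orthonormal basis, so that the derivative of the
  composition is a sum of products of \<open>C\<^sup>k\<close> functions; this is what makes the
  induction on \<open>k\<close> go through for all inner maps at once.\<close>

lemma Ck_on_compose:
  assumes "open S" "open T" "f ` S \<subseteq> T"
  shows "Ck_on k f S \<Longrightarrow> Ck_on k g T \<Longrightarrow> Ck_on k (\<lambda>x. g (f x)) S"
proof (induction k arbitrary: g)
  case 0
  then show ?case using assms continuous_on_compose2 by auto
next
  case (Suc k)
  let ?Df = "\<lambda>x. frechet_derivative f (at x)" and ?Dg = "\<lambda>y. frechet_derivative g (at y)"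
  show ?case
  proof (rule Ck_on_SucI[OF assms(1)])
    fix x assume x: "x \<in> S"
    have 1: "(f has_derivative ?Df x) (at x)" by (rule Ck_on_has_derivative[OF Suc.prems(1) x])
    have 2: "(g has_derivative ?Dg (f x)) (at (f x))"
      using Ck_on_has_derivative[OF Suc.prems(2)] x assms by auto
    have "linear (?Dg (f x))" using 2 has_derivative_linear by blast
    then have "?Dg (f x) (?Df x v) = (\<Sum>b\<in>Basis. (?Df x v \<bullet> b) *\<^sub>R ?Dg (f x) b)" for v
      by (subst euclidean_representation[symmetric, of "?Df x v"])
        (simp only: linear_sum linear_scale o_def)
    then show "((\<lambda>x. g (f x)) has_derivative
        (\<lambda>v. \<Sum>b\<in>Basis. (?Df x v \<bullet> b) *\<^sub>R ?Dg (f x) b)) (at x)"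
      using has_derivative_compose[OF 1 2] by simp
  next
    fix v
    have "Ck_on k (\<lambda>x. ?Dg (f x) b) S" for b
      by (rule Suc.IH[of "\<lambda>y. ?Dg y b"]) (use Suc.prems Suc.prems[THEN Ck_on_SucD] in auto)
    then show "Ck_on k (\<lambda>x. \<Sum>b\<in>Basis. (?Df x v \<bullet> b) *\<^sub>R ?Dg (f x) b) S"
      using Suc.prems
      by (intro Ck_on_sum Ck_on_scaleR Ck_on_bounded_linear_comp[OF bounded_linear_inner_left] assms) auto
  qed
qed

lemma Ck_on_componentwise:
  fixes f :: "'a::euclidean_space \<Rightarrow> real^'n"
  assumes "open S" "\<And>i. Ck_on k (\<lambda>x. f x $ i) S"
  shows "Ck_on k f S"
proof (rule Ck_on_cong[OF assms(1)])
  show "Ck_on k (\<lambda>x. \<Sum>i\<in>UNIV. f x $ i *\<^sub>R axis i (1::real)) S"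
    by (intro Ck_on_sum Ck_on_scaleR Ck_on_const assms)
  show "(\<Sum>i\<in>UNIV. f x $ i *\<^sub>R axis i (1::real)) = f x" for x
    using basis_expansion[of "f x"] by (simp add: scalar_mult_eq_scaleR)
qed

lemma Ck_on_inverse_real: "Ck_on k (inverse :: real \<Rightarrow> real) (- {0})"
proof (induction k)
  case 0
  then show ?case by (auto intro!: continuous_intros)
next
  case (Suc k)
  have o: "open (- {0::real})" by auto
  show ?case
  proof (rule Ck_on_SucI[OF o])
    show "(inverse has_derivative (\<lambda>v. - (inverse x * v * inverse x))) (at x)" if "x \<in> - {0}" for x :: real
      using that by (intro has_derivative_inverse') auto
    show "Ck_on k (\<lambda>x. - (inverse x * v * inverse x)) (- {0})" for v :: real
      by (intro Ck_on_minus Ck_on_mult Ck_on_const o Suc)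
  qed
qed

lemma Ck_on_divide:
  fixes f g :: "'a::euclidean_space \<Rightarrow> real"
  assumes "open S" "Ck_on k f S" "Ck_on k g S" "\<And>x. x \<in> S \<Longrightarrow> g x \<noteq> 0"
  shows "Ck_on k (\<lambda>x. f x / g x) S"
  unfolding divide_inverse
  by (intro Ck_on_mult assms Ck_on_compose[OF _ _ _ _ Ck_on_inverse_real]) (use assms in auto)

lemma smooth_onD: "smooth_on S f \<Longrightarrow> Ck_on k f S" and smooth_on_open: "smooth_on S f \<Longrightarrow> open S"
  by (auto simp: smooth_on_def)

lemma smooth_onI: "open S \<Longrightarrow> (\<And>k. Ck_on k f S) \<Longrightarrow> smooth_on S f"
  by (auto simp: smooth_on_def)

lemma smooth_on_subset: "smooth_on S f \<Longrightarrow> open T \<Longrightarrow> T \<subseteq> S \<Longrightarrow> smooth_on T f"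
  by (auto simp: smooth_on_def intro: Ck_on_subset)

lemma smooth_on_cong: "smooth_on S f \<Longrightarrow> (\<And>x. x \<in> S \<Longrightarrow> f x = g x) \<Longrightarrow> smooth_on S g"
  using Ck_on_cong[of S f g] by (auto simp: smooth_on_def)

lemma smooth_on_compose:
  "smooth_on S f \<Longrightarrow> smooth_on T g \<Longrightarrow> f ` S \<subseteq> T \<Longrightarrow> smooth_on S (\<lambda>x. g (f x))"
  by (auto simp: smooth_on_def intro: Ck_on_compose[of S T])

lemma smooth_on_linear_comp:
  "bounded_linear L \<Longrightarrow> smooth_on S f \<Longrightarrow> smooth_on S (\<lambda>x. L (f x))"
  by (auto simp: smooth_on_def intro: Ck_on_bounded_linear_comp)

lemma smooth_on_has_derivative:
  "smooth_on S f \<Longrightarrow> x \<in> S \<Longrightarrow> (f has_derivative frechet_derivative f (at x)) (at x)"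
  using Ck_on_has_derivative[of 0] smooth_onD by blast

lemma smooth_on_derivative:
  "smooth_on S f \<Longrightarrow> smooth_on S (\<lambda>x. frechet_derivative f (at x) v)"
  unfolding smooth_on_def using Ck_on.simps(2) by blast

lemma smooth_on_continuous: "smooth_on S f \<Longrightarrow> continuous_on S f"
  using smooth_onD[of S f 0] by simp

lemma smooth_on_local:
  assumes "\<And>x. x \<in> S \<Longrightarrow> \<exists>T. x \<in> T \<and> smooth_on T f" "open S"
  shows "smooth_on S f"
  using assms by (intro smooth_onI Ck_on_local) (meson smooth_on_def)+

section \<open>Smoothness of inverse maps\<close>

text \<open>The inverse of a linear map of the plane by Cramer's rule. The explicit quotient shows
  that the inverse depends smoothly on the map.\<close>

definition cramer :: "(real^2 \<Rightarrow> real^2) \<Rightarrow> real^2 \<Rightarrow> real^2" where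
  "cramer L w =
     (let a = L (axis 1 1); b = L (axis 2 1); D = det (matrix L)
      in vector [(w$1 * b$2 - w$2 * b$1) / D, (a$1 * w$2 - a$2 * w$1) / D])"

lemma det_matrix_2: "det (matrix L) =
    L (axis 1 1) $ 1 * L (axis 2 1) $ 2 - L (axis 2 1) $ 1 * L (axis 1 1) $ 2"
  for L :: "real^2 \<Rightarrow> real^2"
  by (simp add: det_2 matrix_def)

lemma linear_on_plane:
  fixes v :: "real^2"
  assumes "linear L"
  shows "L v = v$1 *\<^sub>R L (axis 1 1) + v$2 *\<^sub>R L (axis 2 1)"
proof -
  have "v = v$1 *\<^sub>R axis 1 1 + v$2 *\<^sub>R axis 2 1"
    by (simp add: vec_eq_iff forall_2 axis_def)
  then have "L v = L (v$1 *\<^sub>R axis 1 1 + v$2 *\<^sub>R axis 2 1)" by simp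
  then show ?thesis by (simp only: linear_add[OF assms] linear_scale[OF assms])
qed

lemma cramer_inverse:
  assumes "linear L" "det (matrix L) \<noteq> 0"
  shows "cramer L (L v) = v" "L (cramer L w) = w"
proof -
  let ?a = "L (axis 1 1)" and ?b = "L (axis 2 1)"
  have D: "?a$1 * ?b$2 - ?b$1 * ?a$2 \<noteq> 0" using assms(2) by (simp add: det_matrix_2)
  show "cramer L (L v) = v"
    unfolding cramer_def Let_def linear_on_plane[OF assms(1), of v] det_matrix_2
    using D by (simp add: vec_eq_iff forall_2 field_simps) 
  show "L (cramer L w) = w"
    unfolding linear_on_plane[OF assms(1), of "cramer L w"]
    unfolding cramer_def Let_def det_matrix_2
    using D by (simp add: vec_eq_iff forall_2 divide_simps) (simp add: algebra_simps)
qed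

lemma bounded_linear_cramer:  "bounded_linear (cramer L)"
  unfolding cramer_def Let_def
  by (intro linear_conv_bounded_linear[THEN iffD1] linearI)
    (auto simp: vec_eq_iff forall_2 algebra_simps add_divide_distrib diff_divide_distrib)

lemma Ck_on_cramer:
  assumes "smooth_on S G" "\<And>u. u \<in> S \<Longrightarrow> det (matrix (frechet_derivative G (at u))) \<noteq> 0"
    and "Ck_on k w S"
  shows "Ck_on k (\<lambda>u. cramer (frechet_derivative G (at u)) (w u)) S"
proof (rule Ck_on_componentwise)
  have o: "open S" using assms smooth_on_open by blast
  then show "open S" .
  have d: "Ck_on k (\<lambda>u. frechet_derivative G (at u) v $ i) S" for v i
    by (intro Ck_on_nth o) (use assms(1) smooth_on_derivative smooth_onD in blast)
  have D: "Ck_on k (\<lambda>u. det (matrix (frechet_derivative G (at u)))) S"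
    unfolding det_matrix_2 by (intro Ck_on_diff Ck_on_mult o d)
  fix i :: 2
  have "i = 1 \<or> i = 2" by (rule exhaust_2)
  then show "Ck_on k (\<lambda>u. cramer (frechet_derivative G (at u)) (w u) $ i) S"
    by (auto simp: cramer_def Let_def assms(2)
        intro!: Ck_on_divide Ck_on_diff Ck_on_mult Ck_on_nth[where f = w] D o d assms(3))
qed

lemma inverse_has_derivative_cramer:
  fixes G h :: "real^2 \<Rightarrow> real^2"
  assumes "smooth_on S G" "det (matrix (frechet_derivative G (at (h y)))) \<noteq> 0"
    and "open D" "continuous_on D h" "h ` D \<subseteq> S" "\<And>y. y \<in> D \<Longrightarrow> G (h y) = y" "y \<in> D"
  shows "(h has_derivative cramer (frechet_derivative G (at (h y)))) (at y)"
proof (rule has_derivative_inverse_basic)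
  show dG: "(G has_derivative frechet_derivative G (at (h y))) (at (h y))"
    using assms by (intro smooth_on_has_derivative) auto
  show "cramer (frechet_derivative G (at (h y))) \<circ> frechet_derivative G (at (h y)) = id"
    using cramer_inverse(1)[OF has_derivative_linear[OF dG] assms(2)] by auto
  show "continuous (at y) h" using assms continuous_on_eq_continuous_at by blast
qed (use assms bounded_linear_cramer in auto)

text \<open>The derivative of the inverse \<open>h\<close> at \<open>y\<close> is a smooth
  function of \<open>h y\<close>, so each degree of regularity of \<open>h\<close> gives the next
  one. The induction starts from the continuity of \<open>h\<close>.\<close>

lemma smooth_on_inverse:
  fixes G h :: "real^2 \<Rightarrow> real^2"
  assumes "smooth_on S G" "\<And>u. u \<in> S \<Longrightarrow> det (matrix (frechet_derivative G (at u))) \<noteq> 0"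
    and "open D" "continuous_on D h" "h ` D \<subseteq> S" "\<And>y. y \<in> D \<Longrightarrow> G (h y) = y"
  shows "smooth_on D h"
proof (rule smooth_onI)
  show "Ck_on k h D" for k
  proof (induction k)
    case 0
    then show ?case using assms by simp
  next
    case (Suc k)
    have S: "open S" using assms smooth_on_open by blast
    show ?case
    proof (rule Ck_on_SucI[OF assms(3)])
      show "(h has_derivative cramer (frechet_derivative G (at (h y)))) (at y)" if "y \<in> D" for y
        using assms that by (intro inverse_has_derivative_cramer) auto
      show "Ck_on k (\<lambda>y. cramer (frechet_derivative G (at (h y))) v) D" for v
        by (rule Ck_on_compose[OF assms(3) S assms(5) Suc Ck_on_cramer[OF assms(1,2)]])
          (auto intro: Ck_on_const S)
    qed
  qed
qed (use assms in auto)

section \<open>A smooth cutoff\<close>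

text \<open>The functions \<open>x\<^sup>-\<^sup>n exp (-1/x)\<close>, extended by
  \<open>0\<close> to \<open>x \<le> 0\<close>. The whole family is considered because its linear
  span is closed under differentiation; the case \<open>n = 0\<close> is the standard smooth
  function that vanishes exactly on the nonpositive numbers.\<close>

definition flat_fun :: "nat \<Rightarrow> real \<Rightarrow> real" where
  "flat_fun n x = (if x \<le> 0 then 0 else inverse x ^ n * exp (- inverse x))"

lemma flat_fun_tendsto_0: "(flat_fun n \<longlongrightarrow> 0) (at 0)"
proof -
  have "((\<lambda>x. inverse x ^ n / exp (inverse x)) \<longlongrightarrow> (0::real)) (at_right 0)"
    by (rule filterlim_compose[OF tendsto_power_div_exp_0 filterlim_inverse_at_top_right])
  moreover have "\<forall>\<^sub>F x in at_right 0. inverse x ^ n / exp (inverse x) = flat_fun n x"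
    by (rule eventually_mono[OF eventually_at_right_less])
      (simp add: flat_fun_def exp_minus divide_inverse)
  ultimately have r: "(flat_fun n \<longlongrightarrow> 0) (at_right 0)" by (simp only: tendsto_cong)
  have "\<forall>\<^sub>F x::real in at_left 0. x < 0" by (simp add: eventually_at_filter)
  then have "\<forall>\<^sub>F x in at_left 0. 0 = flat_fun n x"
    by eventually_elim (simp add: flat_fun_def)
  then have "(flat_fun n \<longlongrightarrow> 0) (at_left 0)" using tendsto_cong[THEN iffD1] tendsto_const by fast
  then show ?thesis using r by (simp add: filterlim_at_split)
qed

text \<open>At \<open>0\<close> the difference quotient is again a function of the family, with
  the next exponent, and tends to \<open>0\<close>.\<close>

lemma flat_fun_has_derivative:
  "(flat_fun n has_real_derivative flat_fun (n + 2) x - n * flat_fun (n + 1) x) (at x)"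
proof (cases x "0::real" rule: linorder_cases)
  case less
  have "((\<lambda>x. 0::real) has_real_derivative 0) (at x)" by simp
  then have "(flat_fun n has_real_derivative 0) (at x)"
    by (rule has_field_derivative_transform_within_open[where S = "{..<0}"])
      (use less in \<open>auto simp: flat_fun_def\<close>)
  then show ?thesis using less by (simp add: flat_fun_def)
next
  case equal
  have "((\<lambda>y. flat_fun n y / y) \<longlongrightarrow> 0) (at 0)"
  proof (rule tendsto_cong[THEN iffD1, OF _ flat_fun_tendsto_0[of "n + 1"]])
    have "\<forall>\<^sub>F y::real in at 0. y \<noteq> 0" by (simp add: eventually_at_filter)
    then show "\<forall>\<^sub>F y in at 0. flat_fun (n + 1) y = flat_fun n y / y"
      by eventually_elim (simp add: flat_fun_def field_simps)
  qed
  moreover have "flat_fun m 0 = 0" for m by (simp add: flat_fun_def)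
  ultimately show ?thesis using equal by (simp add: has_field_derivative_iff)
next
  case greater
  have "((\<lambda>x. inverse x ^ n * exp (- inverse x)) has_real_derivative
     inverse x ^ (n + 2) * exp (- inverse x) - n * (inverse x ^ (n + 1) * exp (- inverse x))) (at x)"
    using greater
    apply (auto intro!: derivative_eq_intros)
    apply (cases n)
    apply (auto simp: field_simps)
    done
  then have "(flat_fun n has_real_derivative
     inverse x ^ (n + 2) * exp (- inverse x) - n * (inverse x ^ (n + 1) * exp (- inverse x))) (at x)"
    by (rule has_field_derivative_transform_within_open[where S = "{0<..}"])
      (use greater in \<open>auto simp: flat_fun_def\<close>)
  then show ?thesis using greater by (simp add: flat_fun_def)
qed

lemma Ck_on_flat_fun: "Ck_on k (flat_fun n) UNIV"
proof (induction k arbitrary: n)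
  case 0
  then show ?case
    by (auto intro!: continuous_at_imp_continuous_on DERIV_isCont flat_fun_has_derivative)
next
  case (Suc k)
  show ?case
  proof (rule Ck_on_SucI[OF open_UNIV])
    show "(flat_fun n has_derivative (\<lambda>v. (flat_fun (n + 2) x - n * flat_fun (n + 1) x) * v)) (at x)" for x
      using flat_fun_has_derivative has_field_derivative_imp_has_derivative by blast
    show "Ck_on k (\<lambda>x. (flat_fun (n + 2) x - n * flat_fun (n + 1) x) * v) UNIV" for v
      by (intro Ck_on_diff Ck_on_mult Ck_on_const Suc open_UNIV)
  qed
qed

text \<open>The local description of the surface has a function on a disc, while the model surface
  is the graph of a function on the whole plane; halving the radius leaves room for a
  cutoff.\<close>

lemma smooth_extension_from_ball:
  fixes h :: "'a::euclidean_space \<Rightarrow> real"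
  assumes "smooth_on (ball x r) h" "r > 0"
  obtains l where "smooth_on UNIV l" "\<And>y. y \<in> ball x (r / 2) \<Longrightarrow> l y = h y"
proof -
  define s where "s y = (y - x) \<bullet> (y - x)" for y
  \<comment> \<open>the cutoff is 1 where s is at most a and 0 where s is at least b\<close>
  define a b where "a = (r / 2)\<^sup>2" and "b = (3 * r / 4)\<^sup>2"
  have s: "s y = (dist x y)\<^sup>2" for y
    by (simp add: s_def dist_norm norm_minus_commute[of x] power2_norm_eq_inner)
  have ab: "0 < a" "a < b" using assms(2) unfolding a_def b_def by (auto simp: power_mult_distrib field_simps)
  define \<beta> where "\<beta> y = flat_fun 0 (b - s y) / (flat_fun 0 (b - s y) + flat_fun 0 (s y - a))" for y
  \<comment> \<open>since a < b, at least one of the two arguments is positive\<close>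
  have pos: "flat_fun 0 (b - s y) + flat_fun 0 (s y - a) \<noteq> 0" for y
    using ab by (auto simp: flat_fun_def add_pos_pos less_imp_neq[symmetric])
  have "Ck_on k s UNIV" for k
    unfolding s_def
    by (intro Ck_on_bilinear[OF bounded_bilinear_inner] Ck_on_diff Ck_on_const open_UNIV
        Ck_on_linear[OF bounded_linear_ident])
  then have sm: "Ck_on k \<beta> UNIV" for k
    unfolding \<beta>_def
    by (intro Ck_on_divide Ck_on_add open_UNIV pos
        Ck_on_compose[OF open_UNIV open_UNIV _ _ Ck_on_flat_fun] Ck_on_diff Ck_on_const) auto
  define l where "l y = (if y \<in> ball x r then \<beta> y * h y else 0)" for y
  have "smooth_on UNIV l"
  proof (rule smooth_on_local)
    fix y
    show "\<exists>T. y \<in> T \<and> smooth_on T l"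
    proof (cases "y \<in> ball x r")
      case True
      have "Ck_on k (\<lambda>y. \<beta> y * h y) (ball x r)" for k
        by (intro Ck_on_mult Ck_on_subset[OF sm] smooth_onD[OF assms(1)]) auto
      then have "smooth_on (ball x r) (\<lambda>y. \<beta> y * h y)" by (intro smooth_onI) auto
      then have "smooth_on (ball x r) l" by (rule smooth_on_cong) (simp add: l_def)
      then show ?thesis using True by blast
    next
      case False
      let ?T = "- cball x (3 * r / 4)"
      have "\<beta> z = 0" if "z \<in> ?T" for z
      proof -
        have "(3 * r / 4)\<^sup>2 \<le> (dist x z)\<^sup>2" using that assms(2) by (intro power_mono) auto
        then show ?thesis by (simp add: \<beta>_def flat_fun_def s b_def)
      qed
      then have "l z = 0" if "z \<in> ?T" for z using that by (simp add: l_def)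
      moreover have "smooth_on ?T (\<lambda>_. 0 :: real)" by (auto intro!: smooth_onI Ck_on_const)
      ultimately have "smooth_on ?T l" using smooth_on_cong[of ?T "\<lambda>_. 0" l] by simp
      then show ?thesis using False assms(2) by (intro exI[of _ ?T]) auto
    qed
  qed auto
  moreover have "l y = h y" if "y \<in> ball x (r / 2)" for y
  proof -
    have "(dist x y)\<^sup>2 < (r / 2)\<^sup>2" using that by (intro power_strict_mono) auto
    then have "flat_fun 0 (s y - a) = 0" by (simp add: s a_def flat_fun_def)
    then have "\<beta> y = 1" using pos[of y] by (simp add: \<beta>_def)
    then show ?thesis using that assms(2) by (simp add: l_def)
  qed
  ultimately show ?thesis using that by blast
qed

section \<open>The plus null direction of an oriented spacelike plane\<close>

definition spatial :: "real^4 \<Rightarrow> real^3" where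
  "spatial x = vector [x$2, x$3, x$4]"

lemma spatial_nth [simp]: "spatial x $ 1 = x$2" "spatial x $ 2 = x$3" "spatial x $ 3 = x$4"
  by (simp_all add: spatial_def)

lemma bounded_linear_spatial: "bounded_linear spatial"
  by (intro linear_conv_bounded_linear[THEN iffD1] linearI) (simp_all add: vec_eq_iff forall_3)

lemma spatial_linear [simp]:
  "spatial (x + y) = spatial x + spatial y" "spatial (r *\<^sub>R x) = r *\<^sub>R spatial x" "spatial (x - y) = spatial x - spatial y" "spatial 0 = 0"
  by (simp_all add: vec_eq_iff forall_3)

lemma mink_spatial: "mink x y = spatial x \<bullet> spatial y - x$1 * y$1"
  by (simp add: mink_def inner_vec_def sum_3)

lemma mink_linear:
  "mink (x + y) z = mink x z + mink y z" "mink (r *\<^sub>R x) z = r * mink x z"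
  "mink (x - y) z = mink x z - mink y z"
  "mink z (x + y) = mink z x + mink z y" "mink z (r *\<^sub>R x) = r * mink z x"
  "mink z (x - y) = mink z x - mink z y"
  by (simp_all add: mink_def algebra_simps)

unbundle cross3_syntax

text \<open>For linearly independent \<open>x, y, z\<close> the three cross products are, up to
  the factor on the left, the dual basis. The identity recovers \<open>d\<close> from its inner
  products with \<open>x, y, z\<close>.\<close>

lemma dual_basis_expansion:
  fixes x y z d :: "real^3"
  shows "(x \<bullet> (y \<times> z)) *\<^sub>R d =
    (d \<bullet> x) *\<^sub>R (y \<times> z) + (d \<bullet> y) *\<^sub>R (z \<times> x) + (d \<bullet> z) *\<^sub>R (x \<times> y)"
  by (simp add: vec_eq_iff forall_3 cross3_def inner_vec_def sum_3 algebra_simps)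

text \<open>The right-hand side is the Gram determinant of \<open>x, y, z\<close>,
  expanded.\<close>

lemma triple_product_gram:
  fixes x y z :: "real^3"
  shows "(x \<bullet> (y \<times> z))\<^sup>2 =
     (x \<bullet> x) * ((y \<bullet> y) * (z \<bullet> z) - (y \<bullet> z)\<^sup>2)
     - (x \<bullet> y)\<^sup>2 * (z \<bullet> z) - (x \<bullet> z)\<^sup>2 * (y \<bullet> y) + 2 * (x \<bullet> y) * (x \<bullet> z) * (y \<bullet> z)"
  by (simp add: cross3_def inner_vec_def sum_3 power2_eq_square algebra_simps)

definition gram :: "real^4 \<Rightarrow> real^4 \<Rightarrow> real" where
  "gram a b = mink a a * mink b b - (mink a b)\<^sup>2"

text \<open>For a positive basis \<open>a, b\<close> of a spacelike plane, the vector \<open>(1,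
  \<nu>)\<close> is null and normal to the plane. Exactly two unit vectors \<open>\<nu>\<close>
  have this property, one on each side of the plane spanned by the spatial parts; the last
  condition selects the plus direction.\<close>

definition plus_null_dir :: "real^4 \<Rightarrow> real^4 \<Rightarrow> real^3 \<Rightarrow> bool" where
  "plus_null_dir a b \<nu> \<longleftrightarrow>
     norm \<nu> = 1 \<and> \<nu> \<bullet> spatial a = a$1 \<and> \<nu> \<bullet> spatial b = b$1 \<and> \<nu> \<bullet> (spatial a \<times> spatial b) > 0"

text \<open>The solution \<open>\<nu>\<close> of the linear equations in the definition of the
  plus direction together with \<open>\<nu> \<bullet> c = sqrt (gram a b)\<close>, obtained by
  expanding \<open>\<nu>\<close> in the basis dual to \<open>c\<close>, \<open>spatial a\<close>,
  \<open>spatial b\<close>.\<close>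

definition null_dir :: "real^4 \<Rightarrow> real^4 \<Rightarrow> real^3" where
  "null_dir a b =
     (let c = spatial a \<times> spatial b
      in (1 / (c \<bullet> c)) *\<^sub>R
           (sqrt (gram a b) *\<^sub>R c + a$1 *\<^sub>R (spatial b \<times> c) + b$1 *\<^sub>R (c \<times> spatial a)))"

text \<open>For a unit vector \<open>\<nu>\<close> orthogonality of \<open>(1, \<nu>)\<close> to
  \<open>a\<close> and \<open>b\<close> turns the Euclidean Gram determinant of
  \<open>\<nu>\<close> and the spatial parts into the Minkowski Gram determinant of \<open>a,
  b\<close>.\<close>

lemma plus_null_dir_gram:
  assumes "plus_null_dir a b \<nu>"
  shows "\<nu> \<bullet> (spatial a \<times> spatial b) = sqrt (gram a b)" "gram a b > 0" "spatial a \<times> spatial b \<noteq> 0"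
proof -
  have "\<nu> \<bullet> \<nu> = 1" using assms by (simp add: plus_null_dir_def dot_square_norm)
  then have e: "(\<nu> \<bullet> (spatial a \<times> spatial b))\<^sup>2 = gram a b"
    using assms unfolding triple_product_gram plus_null_dir_def
    by (simp add: gram_def mink_spatial power2_eq_square algebra_simps)
  have p: "\<nu> \<bullet> (spatial a \<times> spatial b) > 0" using assms by (simp add: plus_null_dir_def)
  show "\<nu> \<bullet> (spatial a \<times> spatial b) = sqrt (gram a b)"
    using p by (intro real_sqrt_unique[symmetric] e) auto
  show "gram a b > 0" unfolding e[symmetric] using p by simp
  show "spatial a \<times> spatial b \<noteq> 0" using p by auto
qed

text \<open>The plus direction is unique and depends on \<open>a, b\<close> through a
  differentiable formula. Uniqueness gives independence of frames and charts, the formula gives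
  differentiability.\<close>

lemma plus_null_dir_eq:
  assumes "plus_null_dir a b \<nu>"
  shows "\<nu> = null_dir a b"
proof -
  let ?c = "spatial a \<times> spatial b"
  have "(?c \<bullet> ?c) *\<^sub>R \<nu> =
      sqrt (gram a b) *\<^sub>R ?c + a$1 *\<^sub>R (spatial b \<times> ?c) + b$1 *\<^sub>R (?c \<times> spatial a)"
    using dual_basis_expansion[of ?c "spatial a" "spatial b" \<nu>] assms plus_null_dir_gram(1)[OF assms]
    by (simp add: plus_null_dir_def)
  then have "(1 / (?c \<bullet> ?c)) *\<^sub>R ((?c \<bullet> ?c) *\<^sub>R \<nu>) = null_dir a b"
    by (simp add: null_dir_def Let_def)
  then show ?thesis using plus_null_dir_gram(3)[OF assms] by simp
qed

text \<open>The plus direction depends only on the oriented plane, not on the basis.\<close>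

lemma plus_null_dir_combination:
  assumes "plus_null_dir a b \<nu>" "p * s - q * r > 0"
  shows "plus_null_dir (p *\<^sub>R a + q *\<^sub>R b) (r *\<^sub>R a + s *\<^sub>R b) \<nu>"
proof -
  have "spatial (p *\<^sub>R a + q *\<^sub>R b) \<times> spatial (r *\<^sub>R a + s *\<^sub>R b) = (p * s - q * r) *\<^sub>R (spatial a \<times> spatial b)"
    by (simp add: vec_eq_iff forall_3 cross3_def algebra_simps)
  then show ?thesis
    using assms by (simp add: plus_null_dir_def inner_add_right)
qed

lemma vector_4 [simp]:
  "(vector [x, y, z, t] :: ('b::zero)^4) $ 1 = x" "(vector [x, y, z, t] :: 'b^4) $ 2 = y"
  "(vector [x, y, z, t] :: 'b^4) $ 3 = z" "(vector [x, y, z, t] :: 'b^4) $ 4 = t"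
  unfolding vector_def by simp_all

text \<open>Expansion along the first row. The \<open>3 \<times> 3\<close> minors are triple
  products, the form in which they occur in the definition of the plus direction.\<close>

lemma det_4:
  "det (A :: real^4^4) =
     A$1$1 * (vector [A$2$2, A$2$3, A$2$4] \<bullet> (vector [A$3$2, A$3$3, A$3$4] \<times> vector [A$4$2, A$4$3, A$4$4]))
   - A$1$2 * (vector [A$2$1, A$2$3, A$2$4] \<bullet> (vector [A$3$1, A$3$3, A$3$4] \<times> vector [A$4$1, A$4$3, A$4$4]))
   + A$1$3 * (vector [A$2$1, A$2$2, A$2$4] \<bullet> (vector [A$3$1, A$3$2, A$3$4] \<times> vector [A$4$1, A$4$2, A$4$4]))
   - A$1$4 * (vector [A$2$1, A$2$2, A$2$3] \<bullet> (vector [A$3$1, A$3$2, A$3$3] \<times> vector [A$4$1, A$4$2, A$4$3]))"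
proof -
  have f1: "finite {2::4, 3, 4}" "1 \<notin> {2::4, 3, 4}" and f2: "finite {3::4, 4}" "2 \<notin> {3::4, 4}"
    and f3: "finite {4::4}" "3 \<notin> {4::4}" by auto
  show ?thesis
    unfolding det_def UNIV_4
    unfolding sum_over_permutations_insert[OF f1] sum_over_permutations_insert[OF f2]
      sum_over_permutations_insert[OF f3] permutes_sing
    apply (simp add: sign_swap_id permutation_swap_id permutation_compose sign_compose sign_id
        swap_id_eq)
    apply (simp add: inner_vec_def sum_3 cross3_def algebra_simps)
    done
qed

text \<open>The link between the two descriptions of the plus direction, by orthonormal frames and
  by \<open>\<nu> \<bullet> (a' \<times> b') > 0\<close>. Multiplying the matrix with rows
  \<open>(1, 0, 0, 0), n, e\<^sub>3, e\<^sub>4\<close> by \<open>J e\<^sup>T\<close> gives a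
  matrix of Minkowski products, which is almost the identity; comparing determinants shows that
  the triple product has the sign of \<open>det e\<close>.\<close>

lemma darboux_frame_plus_null_dir:
  assumes det: "det (e :: real^4^4) > 0"
    and on: "\<And>i j. mink (e$i) (e$j) = (if i = j then (if i = 1 then -1 else 1) else 0)"
  shows "(e$1 + e$2)$1 \<noteq> 0" (is ?ne)
    and "plus_null_dir (e$3) (e$4) ((1 / (e$1 + e$2)$1) *\<^sub>R spatial (e$1 + e$2))" (is ?pn)
proof -
  define n where "n = e$1 + e$2"
  have null: "mink n n = 0" and n1: "mink n (e$1) = -1" and n2: "mink n (e$2) = 1"
    and n3: "mink n (e$3) = 0" and n4: "mink n (e$4) = 0"
    using on by (simp_all add: n_def mink_linear)
  have "n$1 \<noteq> 0"
  proof
    assume 0: "n$1 = 0"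
    then have "spatial n = 0" using null by (simp add: mink_spatial)
    then show False using n1 0 by (simp add: mink_spatial)
  qed
  then show ne: ?ne unfolding n_def .
  define J :: "real^4^4" where "J = (\<chi> i j. if i = j then (if i = 1 then -1 else 1) else 0)"
  define N :: "real^4^4" where "N = vector [axis 1 1, n, e$3, e$4]"
  have prod: "(N ** J ** transpose e) $ i $ j = mink (N$i) (e$j)" for i j
    by (simp add: matrix_matrix_mult_def J_def sum_4 transpose_def mink_def)
  \<comment> \<open>by orthonormality the last three rows are (-1,1,0,0), (0,0,1,0) and (0,0,0,1);
    the first row consists of the negated time components of the frame\<close>
  have "det (N ** J ** transpose e) = - n$1"
    unfolding det_4 prod
    by (simp add: N_def n1 n2 n3 n4 on, simp add: inner_vec_def sum_3 cross3_def mink_def n_def axis_def)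
  moreover have "det J = -1"
    unfolding det_4 by (simp add: J_def inner_vec_def sum_3 cross3_def)
  moreover have "det N = spatial n \<bullet> (spatial (e$3) \<times> spatial (e$4))"
    unfolding det_4 by (simp add: N_def spatial_def axis_def)
  ultimately have "(spatial n \<bullet> (spatial (e$3) \<times> spatial (e$4))) * det e = n$1"
    by (simp add: det_mul)
  then have "(1 / n$1) * (spatial n \<bullet> (spatial (e$3) \<times> spatial (e$4))) = 1 / det e"
    using det \<open>n$1 \<noteq> 0\<close> by (simp add: field_simps)
  then have "(1 / n$1) * (spatial n \<bullet> (spatial (e$3) \<times> spatial (e$4))) > 0" using det by simp
  moreover have "norm ((1 / n$1) *\<^sub>R spatial n) = 1"
  proof -
    have "(norm (spatial n))\<^sup>2 = (n$1)\<^sup>2"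
      unfolding power2_norm_eq_inner using null by (simp add: mink_spatial power2_eq_square)
    then have "sqrt ((norm (spatial n))\<^sup>2) = sqrt ((n$1)\<^sup>2)" by (rule arg_cong)
    then have "norm (spatial n) = \<bar>n$1\<bar>" by (simp only: real_sqrt_abs abs_norm_cancel)
    then show ?thesis using \<open>n$1 \<noteq> 0\<close> by simp
  qed
  moreover have "(1 / n$1) * (spatial n \<bullet> spatial (e$3)) = e$3$1" "(1 / n$1) * (spatial n \<bullet> spatial (e$4)) = e$4$1"
    using n3 n4 \<open>n$1 \<noteq> 0\<close> by (simp_all add: mink_spatial)
  ultimately show ?pn by (simp add: plus_null_dir_def del: norm_scaleR flip: n_def)
qed

lemma positive_basis_expansion:
  fixes a b v :: "real^2"
  assumes "det (vector [a, b] :: real^2^2) > 0"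
  obtains x y where "v = x *\<^sub>R a + y *\<^sub>R b"
proof
  let ?D = "a$1 * b$2 - a$2 * b$1"
  have "?D \<noteq> 0" using assms by (simp add: det_2)
  then show "v = ((v$1 * b$2 - v$2 * b$1) / ?D) *\<^sub>R a + ((a$1 * v$2 - a$2 * v$1) / ?D) *\<^sub>R b"
    by (simp add: vec_eq_iff forall_2 divide_simps) (simp add: algebra_simps)
qed

text \<open>Passage from the tangent frame \<open>e\<^sub>3, e\<^sub>4\<close> to the coordinate
  basis of the chart; the frame is positively oriented in the chart, so the change of basis has
  positive determinant.\<close>

lemma darboux_frame_null_dir:
  assumes lin: "linear (differential f c u)" and e: "darboux_frame f c u e"
  shows "(e$1 + e$2)$1 \<noteq> 0"
    and "plus_null_dir (differential f c u (axis 1 1)) (differential f c u (axis 2 1))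
           ((1 / (e$1 + e$2)$1) *\<^sub>R spatial (e$1 + e$2))" 
proof -
  let ?L = "differential f c u"
  obtain p q where pq: "e$3 = ?L p" "e$4 = ?L q" and D: "det (vector [p, q] :: real^2^2) > 0"
    using e by (auto simp: darboux_frame_def)
  have D': "p$1 * q$2 - p$2 * q$1 > 0" using D by (simp add: det_2)
  have e': "det e > 0" "\<And>i j. mink (e$i) (e$j) = (if i = j then (if i = 1 then -1 else 1) else 0)"
    using e by (auto simp: darboux_frame_def)
  show "(e$1 + e$2)$1 \<noteq> 0" by (rule darboux_frame_plus_null_dir(1)[OF e'])
  let ?\<nu> = "(1 / (e$1 + e$2)$1) *\<^sub>R spatial (e$1 + e$2)"
  let ?D = "p$1 * q$2 - p$2 * q$1"
  have "plus_null_dir ((q$2 / ?D) *\<^sub>R e$3 + (- p$2 / ?D) *\<^sub>R e$4)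
     ((- q$1 / ?D) *\<^sub>R e$3 + (p$1 / ?D) *\<^sub>R e$4) ?\<nu>"
  proof (rule plus_null_dir_combination[OF darboux_frame_plus_null_dir(2)[OF e']])
    have "(q$2 / ?D) * (p$1 / ?D) - (- p$2 / ?D) * (- q$1 / ?D) = ?D / (?D * ?D)"
      by (simp add: mult.commute flip: diff_divide_distrib)
    also have "\<dots> > 0" using D' by simp
    finally show "(q$2 / ?D) * (p$1 / ?D) - (- p$2 / ?D) * (- q$1 / ?D) > 0" .
  qed
  moreover have "(q$2 / ?D) *\<^sub>R e$3 + (- p$2 / ?D) *\<^sub>R e$4 = ?L (axis 1 1)"
  proof -
    have "(q$2 / ?D) *\<^sub>R p + (- p$2 / ?D) *\<^sub>R q = axis 1 1"
      using D' by (simp add: vec_eq_iff forall_2 axis_def divide_simps)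
    then show ?thesis
      unfolding pq by (simp only: linear_add[OF lin, symmetric] linear_scale[OF lin, symmetric])
  qed
  moreover have "(- q$1 / ?D) *\<^sub>R e$3 + (p$1 / ?D) *\<^sub>R e$4 = ?L (axis 2 1)"
  proof -
    have "(- q$1 / ?D) *\<^sub>R p + (p$1 / ?D) *\<^sub>R q = axis 2 1"
      using D' by (simp add: vec_eq_iff forall_2 axis_def divide_simps)
    then show ?thesis
      unfolding pq by (simp only: linear_add[OF lin, symmetric] linear_scale[OF lin, symmetric])
  qed
  ultimately show "plus_null_dir (?L (axis 1 1)) (?L (axis 2 1)) ?\<nu>" by simp
qed

text \<open>The normal part is defined by a definite description, so existence and uniqueness have
  to be established: existence by subtracting the components along \<open>e\<^sub>3,
  e\<^sub>4\<close>, uniqueness because a spacelike plane contains no nonzero vector orthogonal to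
  itself.\<close>

lemma normal_part_decomposition:
  assumes lin: "linear (differential f c u)" and e: "darboux_frame f c u e"
    and pos: "\<And>v. v \<noteq> 0 \<Longrightarrow> induced_metric f c u v v > 0"
  shows "y - normal_part (range (differential f c u)) y \<in> range (differential f c u)"
proof -
  let ?L = "differential f c u"
  let ?P = "\<lambda>n. (\<forall>t\<in>range ?L. mink n t = 0) \<and> y - n \<in> range ?L"
  obtain p q where pq: "e$3 = ?L p" "e$4 = ?L q" and D: "det (vector [p, q] :: real^2^2) > 0"
    using e by (auto simp: darboux_frame_def)
  have on: "mink (e$3) (e$3) = 1" "mink (e$4) (e$4) = 1" "mink (e$3) (e$4) = 0" "mink (e$4) (e$3) = 0"
    using e by (auto simp: darboux_frame_def)
  define n where "n = y - (mink y (e$3) *\<^sub>R e$3 + mink y (e$4) *\<^sub>R e$4)"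
  have n34: "mink n (e$3) = 0" "mink n (e$4) = 0" by (simp_all add: n_def mink_linear on)
  have "mink n (?L v) = 0" for v
  proof -
    obtain x z where "v = x *\<^sub>R p + z *\<^sub>R q" using positive_basis_expansion[OF D] .
    then have "?L v = x *\<^sub>R e$3 + z *\<^sub>R e$4" using lin pq by (simp add: linear_add linear_scale)
    then show ?thesis using n34 by (simp add: mink_linear)
  qed
  moreover have "y - n = ?L (mink y (e$3) *\<^sub>R p + mink y (e$4) *\<^sub>R q)"
    using lin pq by (simp add: n_def linear_add linear_scale)
  ultimately have ex: "?P n" by auto
  have un: "m = m'" if P: "?P m" "?P m'" for m m'
  proof -
    obtain v v' where "y - m = ?L v" "y - m' = ?L v'"
      using P by blast
    then have d: "m - m' = ?L (v' - v)" using lin by (simp add: linear_diff algebra_simps)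
    have "mink (m - m') (?L (v' - v)) = 0" using P by (simp add: mink_linear)
    then have "induced_metric f c u (v' - v) (v' - v) = 0" by (simp add: induced_metric_def d)
    then have "v' - v = 0" using pos[of "v' - v"] by fastforce
    then show ?thesis using d lin by (simp add: linear_0)
  qed
  have "?P (normal_part (range ?L) y)"
    unfolding normal_part_def by (rule theI[of ?P, OF ex]) (rule un[OF _ ex])
  then show ?thesis by (rule conjunct2)
qed

text \<open>Isotropy in the form in which it is used: \<open>(1, \<nu>)\<close> is orthogonal to
  all second derivatives, since it is orthogonal to their tangential part, and to their normal
  part, which is a multiple of the null vector \<open>(1, \<nu>)\<close>.\<close>

lemma isotropic_second_derivative:
  assumes lin: "linear (differential f c u)"
    and pos: "\<And>v. v \<noteq> 0 \<Longrightarrow> induced_metric f c u v v > 0"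
    and II: "second_fundamental_form f c u v w \<in> plus_null_normal f c u"
  defines "\<nu> \<equiv> null_dir (differential f c u (axis 1 1)) (differential f c u (axis 2 1))"
    and "y \<equiv> frechet_derivative (\<lambda>u'. differential f c u' w) (at u) v"
  shows "plus_null_dir (differential f c u (axis 1 1)) (differential f c u (axis 2 1)) \<nu>"
    and "\<nu> \<bullet> spatial y = y$1"
proof -
  let ?L = "differential f c u"
  let ?n = "normal_part (range ?L) y"
  obtain s e where e: "darboux_frame f c u e" and s: "?n = s *\<^sub>R (e$1 + e$2)"
    using II by (auto simp: second_fundamental_form_def plus_null_normal_def y_def)
  note pn = darboux_frame_null_dir[OF lin e]
  have \<nu>: "\<nu> = (1 / (e$1 + e$2)$1) *\<^sub>R spatial (e$1 + e$2)"
    using plus_null_dir_eq[OF pn(2)] by (simp add: \<nu>_def)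
  show pn': "plus_null_dir (?L (axis 1 1)) (?L (axis 2 1)) \<nu>" using pn(2) \<nu> by simp
  have spatial_n: "spatial ?n = ?n$1 *\<^sub>R \<nu>" using pn(1) unfolding s \<nu> by (simp del: spatial_linear(1) vector_add_component)
  have "\<nu> \<bullet> \<nu> = 1" using pn' by (simp add: plus_null_dir_def dot_square_norm)
  then have 1: "\<nu> \<bullet> spatial ?n = ?n$1" by (simp add: spatial_n)
  obtain t where t: "y - ?n = ?L t" using normal_part_decomposition[OF lin e pos] by blast
  have "\<nu> \<bullet> spatial (?L t) = ?L t $ 1"
    using pn' unfolding linear_on_plane[OF lin, of t] plus_null_dir_def by (simp add: inner_add_right)
  then have "\<nu> \<bullet> spatial (y - ?n) = (y - ?n) $ 1" by (simp only: t)
  then show "\<nu> \<bullet> spatial y = y$1" using 1 by (simp add: inner_diff_right)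
qed

section \<open>The null direction of an isotropic surface is constant\<close>

lemma chart_facts:
  assumes "is_chart c"
  shows "open (fst c)" "open (chart_image c)" "continuous_on (fst c) (snd c)"
    "continuous_on (chart_image c) (chart_inv c)"
    "\<And>u. u \<in> chart_image c \<Longrightarrow> chart_inv c u \<in> fst c"
    "\<And>u. u \<in> chart_image c \<Longrightarrow> snd c (chart_inv c u) = u"
    "\<And>q. q \<in> fst c \<Longrightarrow> chart_inv c (snd c q) = q"
proof -
  have h: "homeomorphism (fst c) (chart_image c) (snd c) (chart_inv c)"
    using assms by (simp add: is_chart_def)
  show "open (fst c)" "open (chart_image c)" using assms by (auto simp: is_chart_def)
  show "continuous_on (fst c) (snd c)" "continuous_on (chart_image c) (chart_inv c)"
    using h by (auto simp: homeomorphism_def)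
  show "chart_inv c u \<in> fst c" "snd c (chart_inv c u) = u" if "u \<in> chart_image c" for u
    using that by (auto intro: inv_into_into f_inv_into_f)
  show "chart_inv c (snd c q) = q" if "q \<in> fst c" for q
    using h that by (auto simp: homeomorphism_def)
qed

lemma chart_image_open_subset:
  assumes "is_chart c" "open W"
  shows "open (snd c ` (fst c \<inter> W))"
proof -
  have "open (chart_image c \<inter> chart_inv c -` W)"
    using chart_facts[OF assms(1)] assms(2) by (intro continuous_open_preimage)
  moreover have "chart_image c \<inter> chart_inv c -` W = snd c ` (fst c \<inter> W)"
    using chart_facts[OF assms(1)] by force
  ultimately show ?thesis by simp
qed

lemma chart_preimage_open:
  assumes "is_chart c" "open W"
  shows "open (fst c \<inter> snd c -` W)"
  using chart_facts[OF assms(1)] assms(2) by (intro continuous_open_preimage)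

lemma oriented_atlasD:
  assumes "oriented_atlas A"
  shows "\<And>c. c \<in> A \<Longrightarrow> is_chart c" "\<And>q. \<exists>c\<in>A. q \<in> fst c"
    "\<And>c d. c \<in> A \<Longrightarrow> d \<in> A \<Longrightarrow> oriented_transition c d"
  using assms by (auto simp: oriented_atlas_def)

text \<open>The value is constant on discs in charts, hence locally constant, hence
  constant.\<close>

lemma constant_if_chart_derivative_zero:
  fixes h :: "'a::topological_space \<Rightarrow> 'b::real_normed_vector"
  assumes A: "oriented_atlas A" and conn: "connected (UNIV :: 'a set)"
    and d: "\<And>c u. c \<in> A \<Longrightarrow> u \<in> chart_image c \<Longrightarrow> (local_rep h c has_derivative (\<lambda>_. 0)) (at u)"
  shows "h p = h q"
proof (rule connected_local_const[OF conn UNIV_I UNIV_I], intro ballI)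
  fix a :: 'a
  obtain c where c: "c \<in> A" "a \<in> fst c" using oriented_atlasD(2)[OF A] by blast
  note ch = chart_facts[OF oriented_atlasD(1)[OF A c(1)]]
  have "snd c a \<in> chart_image c" using c by auto
  then obtain r where r: "r > 0" "ball (snd c a) r \<subseteq> chart_image c"
    using ch(2) open_contains_ball by blast
  have const: "local_rep h c u = local_rep h c (snd c a)" if "u \<in> ball (snd c a) r" for u
  proof (rule has_derivative_zero_unique[of "ball (snd c a) r"])
    show "(local_rep h c has_derivative (\<lambda>_. 0)) (at u within ball (snd c a) r)"
      if "u \<in> ball (snd c a) r" for u
      using d[OF c(1)] that r(2) has_derivative_at_withinI by blast
  qed (use that r in auto)
  let ?U = "fst c \<inter> snd c -` ball (snd c a) r"
  have "open ?U" by (rule chart_preimage_open[OF oriented_atlasD(1)[OF A c(1)]]) auto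
  moreover have "a \<in> ?U" using c r by auto
  moreover have "h a = h b" if "b \<in> ?U" for b
    using const[of "snd c b"] that c(2) by (simp add: local_rep_def ch(7))
  ultimately show "\<forall>\<^sub>F b in at a within UNIV. h a = h b"
    unfolding eventually_at_topological by blast
qed

lemma differential_change_of_chart:
  fixes f :: "'a::topological_space \<Rightarrow> 'b::euclidean_space"
  assumes c: "is_chart c" and d: "is_chart d" and tr: "oriented_transition c d"
    and f: "smooth_on (chart_image d) (local_rep f d)" and q: "q \<in> fst c" "q \<in> fst d"
  obtains T where "linear T" "det (matrix T) > 0"
    "(local_rep f c has_derivative (\<lambda>v. differential f d (snd d q) (T v))) (at (snd c q))"
    "\<And>v. differential f c (snd c q) v = differential f d (snd d q) (T v)"
proof -
  let ?D = "snd c ` (fst c \<inter> fst d)" and ?\<tau> = "snd d \<circ> chart_inv c"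
  let ?T = "frechet_derivative ?\<tau> (at (snd c q))"
  note cf = chart_facts[OF c] and df = chart_facts[OF d]
  have sm: "smooth_on ?D ?\<tau>" and det: "\<And>u. u \<in> ?D \<Longrightarrow> det (matrix (frechet_derivative ?\<tau> (at u))) > 0"
    using tr by (auto simp: oriented_transition_def Let_def)
  have qD: "snd c q \<in> ?D" using q by auto
  have T: "(?\<tau> has_derivative ?T) (at (snd c q))" by (rule smooth_on_has_derivative[OF sm qD])
  have \<tau>q: "?\<tau> (snd c q) = snd d q" using q cf by simp
  have "(local_rep f d has_derivative differential f d (snd d q)) (at (?\<tau> (snd c q)))"
    unfolding differential_def \<tau>q using q by (intro smooth_on_has_derivative[OF f]) auto
  from has_derivative_compose[OF T this]
  have "((\<lambda>u. local_rep f d (?\<tau> u)) has_derivative (\<lambda>v. differential f d (snd d q) (?T v))) (at (snd c q))" .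
  then have main: "(local_rep f c has_derivative (\<lambda>v. differential f d (snd d q) (?T v))) (at (snd c q))"
    by (rule has_derivative_transform_within_open[OF _ smooth_on_open[OF sm] qD])
      (auto simp: local_rep_def cf(7) df(7))
  then have eq: "differential f c (snd c q) = (\<lambda>v. differential f d (snd d q) (?T v))"
    unfolding differential_def using frechet_derivative_at by metis
  show ?thesis
    by (rule that[of ?T]) (use T has_derivative_linear det qD main eq in auto)
qed

lemma differential_linear:
  assumes "smooth_on (chart_image c) (local_rep f c)" "u \<in> chart_image c"
  shows "linear (differential f c u)"
    "(local_rep f c has_derivative differential f c u) (at u)"
  unfolding differential_def
  using smooth_on_has_derivative[OF assms] has_derivative_linear by blast+

definition chart_null_dir :: "('a \<Rightarrow> real^4) \<Rightarrow> 'a chart \<Rightarrow> real^2 \<Rightarrow> real^3" where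
  "chart_null_dir f c u = null_dir (differential f c u (axis 1 1)) (differential f c u (axis 2 1))"

abbreviation is_chart_null_dir :: "('a \<Rightarrow> real^4) \<Rightarrow> 'a chart \<Rightarrow> real^2 \<Rightarrow> real^3 \<Rightarrow> bool" where
  "is_chart_null_dir f c u \<equiv>
     plus_null_dir (differential f c u (axis 1 1)) (differential f c u (axis 2 1))"

lemma chart_null_dir_isotropic:
  assumes imm: "spacelike_immersion A f" and iso: "plus_isotropic A f"
    and c: "c \<in> A" and u: "u \<in> chart_image c"
  shows "is_chart_null_dir f c u (chart_null_dir f c u)"
    and "chart_null_dir f c u \<bullet> spatial (frechet_derivative (\<lambda>u'. differential f c u' w) (at u) v) =
      frechet_derivative (\<lambda>u'. differential f c u' w) (at u) v $ 1"
proof -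
  have f: "smooth_on (chart_image c) (local_rep f c)"
    and pos: "\<And>v. v \<noteq> 0 \<Longrightarrow> induced_metric f c u v v > 0"
    using imm c u by (auto simp: spacelike_immersion_def)
  have II: "second_fundamental_form f c u v w \<in> plus_null_normal f c u" for v w
    using iso c u by (auto simp: plus_isotropic_def)
  note * = isotropic_second_derivative[OF differential_linear(1)[OF f u] pos II, folded chart_null_dir_def]
  show "is_chart_null_dir f c u (chart_null_dir f c u)" by (rule *(1))
  show "chart_null_dir f c u \<bullet> spatial (frechet_derivative (\<lambda>u'. differential f c u' w) (at u) v) =
      frechet_derivative (\<lambda>u'. differential f c u' w) (at u) v $ 1" by (rule *(2))
qed

lemma bounded_bilinear_cross3: "bounded_bilinear ((\<times>) :: real^3 \<Rightarrow> real^3 \<Rightarrow> real^3)"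
  using bilinear_cross bilinear_conv_bounded_bilinear by blast

lemma Ck_on_sqrt: "Ck_on (Suc 0) sqrt {0<..}"
proof (rule Ck_on_SucI)
  show "(sqrt has_derivative (\<lambda>v. inverse (sqrt x) / 2 * v)) (at x)" if "x \<in> {0<..}" for x
    using that DERIV_real_sqrt has_field_derivative_imp_has_derivative by fastforce
  show "Ck_on 0 (\<lambda>x. inverse (sqrt x) / 2 * v) {0<..}" for v
    by (auto intro!: continuous_intros)
qed auto

text \<open>The Gram determinant is positive, so its square root is differentiable. One derivative
  is all that the constancy argument uses.\<close>

lemma chart_null_dir_differentiable:
  assumes f: "smooth_on S F" and S: "S = chart_image c" "F = local_rep f c"
    and pn: "\<And>u. u \<in> S \<Longrightarrow> is_chart_null_dir f c u (chart_null_dir f c u)"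
  shows "Ck_on (Suc 0) (chart_null_dir f c) S"
proof -
  have o: "open S" using f smooth_on_open by blast
  have L: "Ck_on (Suc 0) (\<lambda>u. differential f c u v) S" for v
    using smooth_onD[OF smooth_on_derivative[OF f]] unfolding differential_def S by blast
  note I = Ck_on_bilinear[OF bounded_bilinear_inner o] Ck_on_bilinear[OF bounded_bilinear_cross3 o]
    Ck_on_scaleR[OF o] Ck_on_mult[OF o] Ck_on_diff[OF o] Ck_on_add[OF o] Ck_on_nth[OF o]
    Ck_on_bounded_linear_comp[OF bounded_linear_spatial o] L
  let ?a = "\<lambda>u. differential f c u (axis 1 1)" and ?b = "\<lambda>u. differential f c u (axis 2 1)"
  have g: "Ck_on (Suc 0) (\<lambda>u. gram (?a u) (?b u)) S"
    unfolding gram_def mink_spatial power2_eq_square by (intro I)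
  have sq: "Ck_on (Suc 0) (\<lambda>u. sqrt (gram (?a u) (?b u))) S"
    by (rule Ck_on_compose[OF o open_greaterThan _ g Ck_on_sqrt]) (use pn plus_null_dir_gram(2) in auto)
  have "Ck_on (Suc 0) (\<lambda>u. 1 / ((spatial (?a u) \<times> spatial (?b u)) \<bullet> (spatial (?a u) \<times> spatial (?b u)))) S"
    by (intro Ck_on_divide[OF o] Ck_on_const[OF o] I) (use pn plus_null_dir_gram(3) in auto)
  then show ?thesis
    unfolding chart_null_dir_def[abs_def] null_dir_def Let_def by (intro I sq)
qed

text \<open>The derivative of \<open>\<nu>\<close> is orthogonal to \<open>\<nu>\<close> and to
  the spatial parts of both coordinate vectors. These three vectors are linearly independent
  because their triple product is positive.\<close>

lemma chart_null_dir_derivative_zero: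
  assumes imm: "spacelike_immersion A f" and iso: "plus_isotropic A f"
    and c: "c \<in> A" and u: "u \<in> chart_image c"
  shows "(chart_null_dir f c has_derivative (\<lambda>_. 0)) (at u)"
proof -
  let ?S = "chart_image c" and ?N = "chart_null_dir f c"
  let ?N' = "frechet_derivative ?N (at u)"
  let ?\<D> = "\<lambda>w u. differential f c u w"
  have f: "smooth_on ?S (local_rep f c)"
    using imm c by (auto simp: spacelike_immersion_def)
  note S = smooth_on_open[OF f]
  have pn: "is_chart_null_dir f c u (?N u)" if "u \<in> ?S" for u
    using chart_null_dir_isotropic(1)[OF imm iso c that] .
  have "Ck_on (Suc 0) ?N ?S"
    by (rule chart_null_dir_differentiable[OF f refl refl pn])
  then have N: "(?N has_derivative ?N') (at u)" using u Ck_on_has_derivative by blast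
  have D: "(?\<D> w has_derivative frechet_derivative (?\<D> w) (at u)) (at u)" for w
    using smooth_on_has_derivative[OF smooth_on_derivative[OF f] u] by (simp add: differential_def)
  have "?N' v = 0" for v
  proof -
    \<comment> \<open>isotropy removes the term with the second derivative of the
      immersion\<close>
    have perp: "?N' v \<bullet> spatial (?\<D> w u) = 0"
      if w: "\<And>u'. u' \<in> ?S \<Longrightarrow> ?N u' \<bullet> spatial (?\<D> w u') = ?\<D> w u' $ 1" for w
    proof -
      let ?D' = "frechet_derivative (?\<D> w) (at u)"
      have "((\<lambda>u'. ?N u' \<bullet> spatial (?\<D> w u') - ?\<D> w u' $ 1) has_derivative
         (\<lambda>v. ?N u \<bullet> spatial (?D' v) + ?N' v \<bullet> spatial (?\<D> w u) - ?D' v $ 1)) (at u)"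
        by (intro has_derivative_diff has_derivative_inner N D
            bounded_linear.has_derivative[OF bounded_linear_spatial]
            bounded_linear.has_derivative[OF bounded_linear_vec_nth])
      moreover have "((\<lambda>u'. ?N u' \<bullet> spatial (?\<D> w u') - ?\<D> w u' $ 1) has_derivative (\<lambda>v. 0)) (at u)"
        by (rule has_derivative_transform_within_open[OF _ S u, of "\<lambda>_. 0"]) (use w in auto)
      ultimately have "(\<lambda>v. ?N u \<bullet> spatial (?D' v) + ?N' v \<bullet> spatial (?\<D> w u) - ?D' v $ 1) = (\<lambda>v. 0)"
        by (rule has_derivative_unique)
      from fun_cong[OF this, of v] chart_null_dir_isotropic(2)[OF imm iso c u, of w v]
      show ?thesis by simp
    qed
    have pa: "?N' v \<bullet> spatial (?\<D> (axis 1 1) u) = 0" and pb: "?N' v \<bullet> spatial (?\<D> (axis 2 1) u) = 0"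
      using pn by (auto intro!: perp simp: plus_null_dir_def)
    have pN: "?N' v \<bullet> ?N u = 0"
    proof -
      have "((\<lambda>u'. ?N u' \<bullet> ?N u') has_derivative (\<lambda>v. ?N u \<bullet> ?N' v + ?N' v \<bullet> ?N u)) (at u)"
        by (intro has_derivative_inner N)
      moreover have "((\<lambda>u'. ?N u' \<bullet> ?N u') has_derivative (\<lambda>v. 0)) (at u)"
        by (rule has_derivative_transform_within_open[OF _ S u, of "\<lambda>_. 1"])
          (use pn in \<open>auto simp: plus_null_dir_def dot_square_norm\<close>)
      ultimately have "(\<lambda>v. ?N u \<bullet> ?N' v + ?N' v \<bullet> ?N u) = (\<lambda>v. 0)"
        by (rule has_derivative_unique)
      from fun_cong[OF this, of v] show ?thesis by (simp add: inner_commute)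
    qed
    have "(?N u \<bullet> (spatial (?\<D> (axis 1 1) u) \<times> spatial (?\<D> (axis 2 1) u))) *\<^sub>R ?N' v = 0"
      unfolding dual_basis_expansion pa pb pN by simp
    then show ?thesis using pn[OF u] by (auto simp: plus_null_dir_def)
  qed
  then have "?N' = (\<lambda>_. 0)" by auto
  then show ?thesis using N by metis
qed

lemma is_chart_null_dir_change_of_chart:
  fixes f :: "'a::topological_space \<Rightarrow> real^4"
  assumes "is_chart c" "is_chart d" "oriented_transition c d"
    and f: "smooth_on (chart_image d) (local_rep f d)" and q: "q \<in> fst c" "q \<in> fst d"
    and pn: "is_chart_null_dir f d (snd d q) \<nu>"
  shows "is_chart_null_dir f c (snd c q) \<nu>"
proof -
  obtain T where T: "linear T" "det (matrix T) > 0"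
    and eq: "\<And>v. differential f c (snd c q) v = differential f d (snd d q) (T v)"
    using differential_change_of_chart[OF assms(1-6)] by metis
  have lin: "linear (differential f d (snd d q))" using q by (intro differential_linear f) auto
  show ?thesis
    unfolding eq linear_on_plane[OF lin, of "T _"]
    using T(2) by (intro plus_null_dir_combination[OF pn]) (simp add: det_matrix_2 mult.commute)
qed

text \<open>Since the plus direction does not depend on the chart, the chartwise directions define
  one function on the surface, and it has zero derivative.\<close>

lemma isotropic_null_direction_constant:
  fixes A :: "'a::topological_space chart set"
  assumes A: "oriented_atlas A" and conn: "connected (UNIV :: 'a set)"
    and imm: "spacelike_immersion A f" and iso: "plus_isotropic A f"
  obtains \<nu> where "norm \<nu> = 1"
    "\<And>c u. c \<in> A \<Longrightarrow> u \<in> chart_image c \<Longrightarrow> is_chart_null_dir f c u \<nu>"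
proof -
  have f: "smooth_on (chart_image c) (local_rep f c)" if "c \<in> A" for c
    using imm that by (auto simp: spacelike_immersion_def)
  note ch = chart_facts[OF oriented_atlasD(1)[OF A]]
  define cc where "cc q = (SOME c. c \<in> A \<and> q \<in> fst c)" for q :: 'a
  have cc: "cc q \<in> A" "q \<in> fst (cc q)" for q
    using someI_ex[of "\<lambda>c. c \<in> A \<and> q \<in> fst c"] oriented_atlasD(2)[OF A] unfolding cc_def by blast+
  define h where "h q = chart_null_dir f (cc q) (snd (cc q) q)" for q
  have h_eq: "h q = chart_null_dir f c (snd c q)" and h_pn: "is_chart_null_dir f c (snd c q) (h q)"
    if "c \<in> A" "q \<in> fst c" for c q
  proof -
    have "is_chart_null_dir f (cc q) (snd (cc q) q) (h q)"
      unfolding h_def by (rule chart_null_dir_isotropic[OF imm iso cc(1)]) (use cc in auto)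
    then show pn: "is_chart_null_dir f c (snd c q) (h q)"
      by (rule is_chart_null_dir_change_of_chart[rotated -1])
        (use that cc f oriented_atlasD[OF A] in auto)
    show "h q = chart_null_dir f c (snd c q)"
      using plus_null_dir_eq[OF pn] by (simp add: chart_null_dir_def)
  qed
  have "(local_rep h c has_derivative (\<lambda>_. 0)) (at u)" if "c \<in> A" "u \<in> chart_image c" for c u
    using chart_null_dir_derivative_zero[OF imm iso that]
    by (rule has_derivative_transform_within_open[OF _ ch(2)[OF that(1)] that(2)])
      (use that ch in \<open>auto simp: local_rep_def h_eq\<close>)
  then have const: "h p = h q" for p q by (rule constant_if_chart_derivative_zero[OF A conn])
  show ?thesis
  proof
    show pn: "is_chart_null_dir f c u (h undefined)" if "c \<in> A" "u \<in> chart_image c" for c u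
      using h_pn[OF that(1) ch(5)[OF that]] ch(6)[OF that] const[of undefined "chart_inv c u"] by simp
    have "snd (cc undefined) undefined \<in> chart_image (cc undefined)" using cc by auto
    then show "norm (h undefined) = 1" using pn[OF cc(1)] by (auto simp: plus_null_dir_def)
  qed
qed

section \<open>The surface as a graph over a plane\<close>

lemma affine_mink_isometry:
  assumes B: "bounded_linear B" and B': "bounded_linear B'"
    and inv: "\<And>x. B' (B x) = x" "\<And>x. B (B' x) = x"
    and m: "\<And>x y. mink (B x) (B y) = mink x y"
  shows "mink_isometry (\<lambda>x. B x + t)"
proof -
  let ?\<Phi> = "\<lambda>x. B x + t" and ?\<Psi> = "\<lambda>y. B' (y - t)"
  have i: "?\<Psi> (?\<Phi> x) = x" "?\<Phi> (?\<Psi> y) = y" for x y by (simp_all add: inv)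
  have bij: "bij ?\<Phi>" by (rule bijI') (use i in metis)+
  have inv_eq: "inv ?\<Phi> = ?\<Psi>" using i by (intro inv_unique_comp) auto
  have sm: "smooth_on UNIV ?\<Phi>" "smooth_on UNIV ?\<Psi>"
    by (intro smooth_onI Ck_on_add Ck_on_linear[OF B] Ck_on_const open_UNIV
        Ck_on_bounded_linear_comp[OF B'] Ck_on_diff Ck_on_linear[OF bounded_linear_ident])+
  have "(?\<Phi> has_derivative B) (at p)" for p
    using has_derivative_add[OF bounded_linear_imp_has_derivative[OF B] has_derivative_const[of t]]
    by simp
  then have "frechet_derivative ?\<Phi> (at p) = B" for p using frechet_derivative_at by metis
  then show ?thesis using bij sm m by (simp add: mink_isometry_def inv_eq)
qed

lemma rotation_to_first_axis:
  fixes \<nu> :: "real^3"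
  assumes "norm \<nu> = 1"
  obtains R R' where "bounded_linear R" "bounded_linear R'" "\<And>x. R' (R x) = x" "\<And>x. R (R' x) = x"
    "\<And>x y. R x \<bullet> R y = x \<bullet> y" "\<And>x y. R x \<times> R y = R (x \<times> y)" "\<And>x. R x $ 1 = \<nu> \<bullet> x"
proof -
  obtain R where R: "orthogonal_transformation R" "det (matrix R) = 1" "R \<nu> = (axis 1 1 :: real^3)"
    by (rule rotation_exists[of \<nu> "axis 1 1"]) (use assms in auto)
  have b: "bij R" by (rule orthogonal_transformation_bij[OF R(1)])
  have R': "orthogonal_transformation (inv R)" by (rule orthogonal_transformation_inv[OF R(1)])
  show ?thesis
  proof (rule that[of R "inv R"])
    show "bounded_linear R" "bounded_linear (inv R)"
      using R(1) R' by (simp_all add: orthogonal_transformation_linear linear_conv_bounded_linear[symmetric])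
    show "inv R (R x) = x" "R (inv R x) = x" for x
      using b by (simp_all add: bij_is_inj surj_f_inv_f bij_is_surj)
    show dot: "R x \<bullet> R y = x \<bullet> y" for x y using R(1) by (simp add: orthogonal_transformation_def)
    show "R x \<times> R y = R (x \<times> y)" for x y
      using cross_orthogonal_transformation[OF R(1)] R(2) by simp
    show "R x $ 1 = \<nu> \<bullet> x" for x
      using dot[of x \<nu>] by (simp add: R(3) inner_axis inner_commute)
  qed
qed

text \<open>Rotating \<open>\<nu>\<close> to the first axis makes \<open>(1, 1, 0, 0)\<close> the
  null normal, so the difference of the first two coordinates has zero derivative; the translation
  removes this constant. The orientation of the projection \<open>g\<close> is controlled by the
  same triple product that defines the plus direction, because the rotation has determinant
  \<open>1\<close>.\<close>

lemma isotropic_graph_form: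
  fixes A :: "'a::topological_space chart set" and f :: "'a \<Rightarrow> real^4"
  assumes A: "oriented_atlas A" and conn: "connected (UNIV :: 'a set)"
    and imm: "spacelike_immersion A f" and iso: "plus_isotropic A f"
  obtains \<Phi> g lam where "mink_isometry \<Phi>"
    "\<And>q. \<Phi> (f q) = vector [lam q, lam q, g q $ 1, g q $ 2]"
    "\<And>c. c \<in> A \<Longrightarrow> smooth_on (chart_image c) (local_rep g c)"
    "\<And>c. c \<in> A \<Longrightarrow> smooth_on (chart_image c) (local_rep lam c)"
    "\<And>c u. c \<in> A \<Longrightarrow> u \<in> chart_image c \<Longrightarrow> det (matrix (differential g c u)) > 0"
    "\<And>c u v w. c \<in> A \<Longrightarrow> u \<in> chart_image c \<Longrightarrow>
       differential g c u v \<bullet> differential g c u w = induced_metric f c u v w"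
proof -
  obtain \<nu> where \<nu>: "norm \<nu> = 1"
    and pn: "\<And>c u. c \<in> A \<Longrightarrow> u \<in> chart_image c \<Longrightarrow> is_chart_null_dir f c u \<nu>"
    using isotropic_null_direction_constant[OF assms] by blast
  obtain R R' where R: "bounded_linear R" "bounded_linear R'" "\<And>x. R' (R x) = x" "\<And>x. R (R' x) = x"
    "\<And>x y. R x \<bullet> R y = x \<bullet> y" "\<And>x y. R x \<times> R y = R (x \<times> y)" "\<And>x. R x $ 1 = \<nu> \<bullet> x"
    using rotation_to_first_axis[OF \<nu>] by blast
  have f: "smooth_on (chart_image c) (local_rep f c)" if "c \<in> A" for c
    using imm that by (auto simp: spacelike_immersion_def)
  define ext where "ext Q x = (vector [x$1, Q (spatial x) $ 1, Q (spatial x) $ 2, Q (spatial x) $ 3] :: real^4)"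
    for Q :: "real^3 \<Rightarrow> real^3" and x :: "real^4"
  have ext_bl: "bounded_linear (ext Q)" if "bounded_linear Q" for Q
  proof -
    have "linear Q" using that by (simp add: linear_conv_bounded_linear)
    then show ?thesis unfolding ext_def[abs_def]
      by (intro linear_conv_bounded_linear[THEN iffD1] linearI)
        (simp_all add: vec_eq_iff forall_4 linear_add linear_scale)
  qed
  have ext_spatial: "spatial (ext Q x) = Q (spatial x)" "ext Q x $ 1 = x$1" for Q x
    by (simp_all add: ext_def vec_eq_iff forall_3)
  have spatial_eqI: "x = y" if "spatial x = spatial y" "x$1 = y$1" for x y :: "real^4"
    using that by (simp add: vec_eq_iff forall_3 forall_4)
  have ext_inv: "ext R' (ext R x) = x" "ext R (ext R' x) = x" for x
    by (rule spatial_eqI; simp add: ext_spatial R)+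
  define P where "P x = (vector [R (spatial x) $ 2, R (spatial x) $ 3] :: real^2)" for x
  have P: "bounded_linear P"
  proof -
    have "linear R" using R(1) by (simp add: linear_conv_bounded_linear)
    then show ?thesis unfolding P_def[abs_def]
      by (intro linear_conv_bounded_linear[THEN iffD1] linearI)
        (simp_all add: vec_eq_iff forall_2 linear_add linear_scale)
  qed
  have h0: "\<nu> \<bullet> spatial (differential f c u v) = differential f c u v $ 1"
    if "c \<in> A" "u \<in> chart_image c" for c u v
    using pn[OF that] unfolding linear_on_plane[OF differential_linear(1)[OF f[OF that(1)] that(2)], of v]
    by (simp add: plus_null_dir_def inner_add_right)
  \<comment> \<open>after the rotation this is the difference of the first two coordinates\<close>
  have K: "\<nu> \<bullet> spatial (f p) - f p $ 1 = \<nu> \<bullet> spatial (f q) - f q $ 1" for p q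
  proof (rule constant_if_chart_derivative_zero[OF A conn])
    fix c u assume cu: "c \<in> A" "u \<in> chart_image c"
    have "((\<lambda>u. \<nu> \<bullet> spatial (local_rep f c u) - local_rep f c u $ 1) has_derivative
       (\<lambda>v. \<nu> \<bullet> spatial (differential f c u v) - differential f c u v $ 1)) (at u)"
      by (intro has_derivative_diff has_derivative_inner_right
            bounded_linear.has_derivative[OF bounded_linear_spatial]
            bounded_linear.has_derivative[OF bounded_linear_vec_nth]
            differential_linear(2)[OF f[OF cu(1)] cu(2)])
    then show "(local_rep (\<lambda>q. \<nu> \<bullet> spatial (f q) - f q $ 1) c has_derivative (\<lambda>_. 0)) (at u)"
      using h0[OF cu] by (simp add: local_rep_def o_def)
  qed
  define k where "k = \<nu> \<bullet> spatial (f undefined) - f undefined $ 1"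
  have k: "\<nu> \<bullet> spatial (f q) = f q $ 1 + k" for q using K[of q undefined] by (simp add: k_def)
  have Pf: "differential (\<lambda>q. P (f q)) c u v = P (differential f c u v)"
    if "c \<in> A" "u \<in> chart_image c" for c u v
  proof -
    have "(local_rep (\<lambda>q. P (f q)) c has_derivative (\<lambda>v. P (differential f c u v))) (at u)"
      using bounded_linear.has_derivative[OF P differential_linear(2)[OF f[OF that(1)] that(2)]]
      by (simp add: local_rep_def o_def)
    from frechet_derivative_at[OF this] show ?thesis by (metis differential_def)
  qed
  show ?thesis
  proof (rule that[of "\<lambda>x. ext R x + vector [0, - k, 0, 0]" "\<lambda>q. f q $ 1" "\<lambda>q. P (f q)"])
    show "mink_isometry (\<lambda>x. ext R x + vector [0, - k, 0, 0])"
      by (rule affine_mink_isometry[of _ "ext R'"])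
        (simp_all add: ext_bl R ext_inv mink_spatial ext_spatial)
    show "ext R (f q) + vector [0, - k, 0, 0] = vector [f q $ 1, f q $ 1, P (f q) $ 1, P (f q) $ 2]" for q
      by (simp add: ext_def vec_eq_iff forall_4 R(7) k P_def)
    fix c assume c: "c \<in> A"
    show "smooth_on (chart_image c) (local_rep (\<lambda>q. P (f q)) c)"
      using smooth_on_linear_comp[OF P f[OF c]] by (simp add: local_rep_def o_def)
    show "smooth_on (chart_image c) (local_rep (\<lambda>q. f q $ 1) c)"
      using smooth_on_linear_comp[OF bounded_linear_vec_nth f[OF c]] by (simp add: local_rep_def o_def)
    fix u assume u: "u \<in> chart_image c"
    let ?a = "differential f c u (axis 1 1)" and ?b = "differential f c u (axis 2 1)"
    have "det (matrix (differential (\<lambda>q. P (f q)) c u)) = (R (spatial ?a) \<times> R (spatial ?b)) $ 1"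
      unfolding det_matrix_2 Pf[OF c u] by (simp add: P_def cross3_def)
    also have "\<dots> = \<nu> \<bullet> (spatial ?a \<times> spatial ?b)" by (simp add: R)
    also have "\<dots> > 0" using pn[OF c u] by (simp add: plus_null_dir_def)
    finally show "det (matrix (differential (\<lambda>q. P (f q)) c u)) > 0" .
    show "differential (\<lambda>q. P (f q)) c u v \<bullet> differential (\<lambda>q. P (f q)) c u w = induced_metric f c u v w" for v w
    proof -
      have "P x \<bullet> P y = R (spatial x) \<bullet> R (spatial y) - R (spatial x) $ 1 * R (spatial y) $ 1" for x y
        by (simp add: P_def inner_vec_def sum_2 sum_3)
      then show ?thesis by (simp add: Pf[OF c u] induced_metric_def mink_spatial R h0[OF c u])
    qed
  qed
qed

section \<open>Local inverses of the projection\<close>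

text \<open>The situation after the normalization of the null direction: \<open>g\<close> is an
  orientation-preserving local isometry of the surface, with the metric induced by
  \<open>f\<close>, into the Euclidean plane.\<close>

locale flat_development =
  fixes A :: "'a::t2_space chart set" and f :: "'a \<Rightarrow> real^4" and g :: "'a \<Rightarrow> real^2"
  assumes A: "oriented_atlas A"
    and f_smooth: "c \<in> A \<Longrightarrow> smooth_on (chart_image c) (local_rep f c)"
    and g_smooth: "c \<in> A \<Longrightarrow> smooth_on (chart_image c) (local_rep g c)"
    and g_orientation: "c \<in> A \<Longrightarrow> u \<in> chart_image c \<Longrightarrow> det (matrix (differential g c u)) > 0"
    and g_isometric: "c \<in> A \<Longrightarrow> u \<in> chart_image c \<Longrightarrow>
       differential g c u v \<bullet> differential g c u w = induced_metric f c u v w"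
begin

lemmas chart = chart_facts[OF oriented_atlasD(1)[OF A]]

lemma continuous_if_smooth_in_charts:
  fixes h :: "'a \<Rightarrow> 'b::euclidean_space"
  assumes "\<And>c. c \<in> A \<Longrightarrow> smooth_on (chart_image c) (local_rep h c)"
  shows "continuous_on S h"
proof -
  have "isCont h q" for q
  proof -
    obtain c where c: "c \<in> A" "q \<in> fst c" using oriented_atlasD(2)[OF A] by blast
    have "continuous_on (fst c) (\<lambda>q. local_rep h c (snd c q))"
      by (rule continuous_on_compose2[OF smooth_on_continuous[OF assms[OF c(1)]] chart(3)[OF c(1)]]) auto
    then have "continuous_on (fst c) h"
      by (rule continuous_on_cong[THEN iffD1, rotated -1])
        (auto simp: local_rep_def chart(7)[OF c(1)])
    then show ?thesis using c chart(1)[OF c(1)] continuous_on_eq_continuous_at by blast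
  qed
  then show ?thesis by (simp add: continuous_at_imp_continuous_on)
qed

lemma g_continuous: "continuous_on S g"
  by (rule continuous_if_smooth_in_charts[OF g_smooth])

text \<open>The inverse function theorem in a chart. The neighbourhood is chosen as the exact
  preimage of a disc, so that the sets on which local inverses live are convex.\<close>

lemma local_section:
  obtains r U \<sigma> where "r > 0" "open U" "p \<in> U" "homeomorphism U (ball (g p) r) g \<sigma>"
proof -
  obtain c where c: "c \<in> A" "p \<in> fst c" using oriented_atlasD(2)[OF A] by blast
  let ?S = "chart_image c" and ?G = "local_rep g c" and ?u = "snd c p"
  have S: "open ?S" and u: "?u \<in> ?S" using chart(2)[OF c(1)] c by auto
  define G' where "G' u = Blinfun (differential g c u)" for u
  have bl: "bounded_linear (differential g c u)" if "u \<in> ?S" for u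
    using differential_linear(1)[OF g_smooth[OF c(1)] that] by (simp add: linear_conv_bounded_linear)
  have G': "blinfun_apply (G' u) = differential g c u" if "u \<in> ?S" for u
    unfolding G'_def by (rule bounded_linear_Blinfun_apply[OF bl[OF that]])
  have 1: "(?G has_derivative blinfun_apply (G' u)) (at u)" if "u \<in> ?S" for u
    unfolding G'[OF that] using differential_linear(2)[OF g_smooth[OF c(1)] that] .
  have 2: "continuous_on ?S G'"
  proof (rule continuous_on_blinfun_componentwise)
    fix i :: "real^2"
    have "continuous_on ?S (\<lambda>u. differential g c u i)"
      unfolding differential_def by (rule smooth_on_continuous[OF smooth_on_derivative[OF g_smooth[OF c(1)]]])
    then show "continuous_on ?S (\<lambda>u. blinfun_apply (G' u) i)"
      by (rule continuous_on_cong[THEN iffD1, rotated -1]) (simp_all add: G')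
  qed
  let ?J = "Blinfun (cramer (differential g c ?u))"
  have 3: "?J o\<^sub>L G' ?u = id_blinfun"
    by (rule blinfun_eqI)
      (use cramer_inverse(1)[OF differential_linear(1)[OF g_smooth[OF c(1)] u]] g_orientation[OF c(1) u]
        in \<open>simp add: G'[OF u] bounded_linear_Blinfun_apply[OF bounded_linear_cramer]\<close>)
  obtain U' V k where U': "open U'" "U' \<subseteq> ?S" "?u \<in> U'" and V: "open V" "?G ?u \<in> V"
    and k: "homeomorphism U' V ?G k"
    using inverse_function_theorem[OF S 1 2 u 3] by metis
  have gp: "?G ?u = g p" using c chart(7) by (simp add: local_rep_def)
  then obtain r where r: "r > 0" "ball (g p) r \<subseteq> V" using V open_contains_ball by metis
  let ?B = "ball (g p) r"
  define \<sigma> where "\<sigma> = chart_inv c \<circ> k"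
  have kB: "k y \<in> U'" "k y \<in> ?S" "?G (k y) = y" if "y \<in> ?B" for y
  proof -
    have y: "y \<in> V" using r(2) that by blast
    show "k y \<in> U'" "?G (k y) = y" using k y by (auto simp: homeomorphism_def)
    then show "k y \<in> ?S" using U'(2) by blast
  qed
  have g\<sigma>: "g (\<sigma> y) = y" and \<sigma>c: "\<sigma> y \<in> fst c" and s\<sigma>: "snd c (\<sigma> y) = k y" if "y \<in> ?B" for y
    using kB[OF that] chart[OF c(1)] by (auto simp: local_rep_def \<sigma>_def)
  let ?U = "fst c \<inter> snd c -` (U' \<inter> ?G -` ?B)"
  have "open (U' \<inter> ?G -` ?B)"
    using smooth_on_continuous[OF g_smooth[OF c(1)]] U' by (intro continuous_open_preimage) (auto intro: continuous_on_subset)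
  then have oU: "open ?U" by (rule chart_preimage_open[OF oriented_atlasD(1)[OF A c(1)]])
  have pU: "p \<in> ?U" using c U' r gp by auto
  have Ug: "g q \<in> ?B" "\<sigma> (g q) = q" if "q \<in> ?U" for q
  proof -
    have q: "q \<in> fst c" "snd c q \<in> U'" "?G (snd c q) \<in> ?B" using that by auto
    have e: "?G (snd c q) = g q" using q chart(7)[OF c(1)] by (simp add: local_rep_def)
    then show "g q \<in> ?B" using q by simp
    have "k (g q) = snd c q" using e k q(2) by (metis homeomorphism_apply1)
    then show "\<sigma> (g q) = q" using q chart(7)[OF c(1)] by (simp add: \<sigma>_def)
  qed
  have \<sigma>U: "\<sigma> y \<in> ?U" if "y \<in> ?B" for y
    using that kB[OF that] s\<sigma>[OF that] \<sigma>c[OF that] by auto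
  have "homeomorphism ?U ?B g \<sigma>"
  proof (rule homeomorphismI)
    show "continuous_on ?B \<sigma>"
      unfolding \<sigma>_def using k r kB(2) chart(4)[OF c(1)]
      by (intro continuous_on_compose) (auto simp: homeomorphism_def intro: continuous_on_subset)
  qed (use Ug \<sigma>U g\<sigma> in \<open>auto intro!: g_continuous\<close>)
  then show ?thesis using that r(1) oU pU by blast
qed

text \<open>A continuous inverse of \<open>g\<close>, read in any chart of the atlas, is a
  continuous inverse of a smooth map with invertible derivative. This serves the small discs of
  the local statement and the whole plane in the complete case alike.\<close>

lemma section_smooth:
  assumes U: "open U" and B: "open B" and \<sigma>: "homeomorphism U B g \<sigma>" and d: "d \<in> A"
  defines "D \<equiv> g ` (U \<inter> fst d)"
  shows "open D" "smooth_on D (snd d \<circ> \<sigma>)" "\<And>y. y \<in> D \<Longrightarrow> \<sigma> y \<in> U \<inter> fst d"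
    "\<And>y. y \<in> D \<Longrightarrow> ((snd d \<circ> \<sigma>) has_derivative cramer (differential g d (snd d (\<sigma> y)))) (at y)"
proof -
  have D: "D = B \<inter> \<sigma> -` fst d"
    using \<sigma> unfolding D_def homeomorphism_def by force
  have c\<sigma>: "continuous_on B \<sigma>" using \<sigma> by (simp add: homeomorphism_def)
  show oD: "open D" unfolding D using c\<sigma> B chart(1)[OF d] by (intro continuous_open_preimage)
  show \<sigma>D: "\<sigma> y \<in> U \<inter> fst d" if "y \<in> D" for y
    using that \<sigma> unfolding D by (auto simp: homeomorphism_def)
  have cont: "continuous_on D (snd d \<circ> \<sigma>)"
    using \<sigma>D D by (intro continuous_on_compose continuous_on_subset[OF c\<sigma>] continuous_on_subset[OF chart(3)[OF d]]) auto
  have im: "(snd d \<circ> \<sigma>) ` D \<subseteq> chart_image d" using \<sigma>D by auto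
  have inv: "local_rep g d ((snd d \<circ> \<sigma>) y) = y" if "y \<in> D" for y
    using \<sigma>D[OF that] that \<sigma> D chart(7)[OF d] by (auto simp: local_rep_def homeomorphism_def)
  have det: "det (matrix (frechet_derivative (local_rep g d) (at u))) \<noteq> 0" if "u \<in> chart_image d" for u
    using g_orientation[OF d that] by (simp add: differential_def)
  show "smooth_on D (snd d \<circ> \<sigma>)"
    by (rule smooth_on_inverse[OF g_smooth[OF d] det oD cont im inv])
  show "((snd d \<circ> \<sigma>) has_derivative cramer (differential g d (snd d (\<sigma> y)))) (at y)" if "y \<in> D" for y
  proof -
    have "det (matrix (frechet_derivative (local_rep g d) (at ((snd d \<circ> \<sigma>) y)))) \<noteq> 0"
      by (rule det) (use im that in blast)
    then have "((snd d \<circ> \<sigma>) has_derivative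
        cramer (frechet_derivative (local_rep g d) (at ((snd d \<circ> \<sigma>) y)))) (at y)"
      by (rule inverse_has_derivative_cramer[OF g_smooth[OF d] _ oD cont im inv that])
    then show ?thesis by (simp add: differential_def comp_def)
  qed
qed

lemma smooth_in_section:
  fixes h :: "'a \<Rightarrow> 'b::euclidean_space"
  assumes U: "open U" and B: "open B" and \<sigma>: "homeomorphism U B g \<sigma>"
    and h: "\<And>c. c \<in> A \<Longrightarrow> smooth_on (chart_image c) (local_rep h c)"
  shows "smooth_on B (h \<circ> \<sigma>)"
proof (rule smooth_on_local[OF _ B])
  fix y assume y: "y \<in> B"
  obtain d where d: "d \<in> A" "\<sigma> y \<in> fst d" using oriented_atlasD(2)[OF A] by blast
  let ?D = "g ` (U \<inter> fst d)"
  note s = section_smooth[OF U B \<sigma> d(1)]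
  have "smooth_on ?D (\<lambda>y. local_rep h d ((snd d \<circ> \<sigma>) y))"
    by (rule smooth_on_compose[OF s(2) h[OF d(1)]]) (use s(3) in auto)
  then have "smooth_on ?D (h \<circ> \<sigma>)"
    by (rule smooth_on_cong) (use s(3) chart(7)[OF d(1)] in \<open>auto simp: local_rep_def\<close>)
  moreover have "y \<in> ?D"
  proof (rule image_eqI[of _ _ "\<sigma> y"])
    show "y = g (\<sigma> y)" "\<sigma> y \<in> U \<inter> fst d" using \<sigma> y d(2) by (auto simp: homeomorphism_def)
  qed
  ultimately show "\<exists>T. y \<in> T \<and> smooth_on T (h \<circ> \<sigma>)" by (intro exI[of _ ?D] conjI)
qed

lemma section_oriented_chart:
  assumes U: "open U" and B: "open B" and \<sigma>: "homeomorphism U B g \<sigma>"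
  shows "oriented_chart A (U, g)"
proof -
  have im: "g ` U = B" using \<sigma> by (simp add: homeomorphism_def)
  have inj: "inj_on g U"
    using \<sigma> by (intro inj_on_inverseI[of U \<sigma>]) (simp add: homeomorphism_def)
  have inv: "inv_into U g y = \<sigma> y" if "y \<in> B" for y
  proof -
    have "\<sigma> y \<in> U" "g (\<sigma> y) = y" using \<sigma> that by (auto simp: homeomorphism_def)
    then show ?thesis using inv_into_f_f[OF inj, of "\<sigma> y"] by simp
  qed
  have "homeomorphism U B g (inv_into U g)"
    by (rule homeomorphism_cong[OF \<sigma>]) (use inv in auto)
  then have ch: "is_chart (U, g)" using U B im by (simp add: is_chart_def)
  have 1: "oriented_transition d (U, g)" if d: "d \<in> A" for d
  proof -
    let ?D = "snd d ` (fst d \<inter> U)"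
    have "open ?D" by (rule chart_image_open_subset[OF oriented_atlasD(1)[OF A d] U])
    then have "smooth_on ?D (local_rep g d)"
      by (rule smooth_on_subset[OF g_smooth[OF d]]) auto
    then show ?thesis
      using g_orientation[OF d] by (auto simp: oriented_transition_def Let_def local_rep_def differential_def)
  qed
  have 2: "oriented_transition (U, g) d" if d: "d \<in> A" for d
  proof -
    let ?D = "g ` (U \<inter> fst d)"
    note s = section_smooth[OF U B \<sigma> d]
    have e: "(snd d \<circ> \<sigma>) y = (snd d \<circ> inv_into U g) y" if "y \<in> ?D" for y
      using that im inv by auto
    have sm: "smooth_on ?D (snd d \<circ> inv_into U g)"
      by (rule smooth_on_cong[OF s(2) e])
    have "det (matrix (frechet_derivative (snd d \<circ> inv_into U g) (at y))) > 0" if y: "y \<in> ?D" for y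
    proof -
      let ?L = "differential g d (snd d (\<sigma> y))"
      have u: "snd d (\<sigma> y) \<in> chart_image d" using s(3)[OF y] by auto
      have L: "linear ?L" by (rule differential_linear(1)[OF g_smooth[OF d] u])
      have "((snd d \<circ> inv_into U g) has_derivative cramer ?L) (at y)"
        by (rule has_derivative_transform_within_open[OF s(4)[OF y] s(1) y e])
      then have "frechet_derivative (snd d \<circ> inv_into U g) (at y) = cramer ?L"
        using frechet_derivative_at by metis
      moreover have "det (matrix (cramer ?L)) > 0"
      proof -
        have "cramer ?L \<circ> ?L = id"
          using cramer_inverse(1)[OF L] g_orientation[OF d u] by auto
        then have "matrix (cramer ?L) ** matrix ?L = mat 1"
          using matrix_compose[OF L bounded_linear.linear[OF bounded_linear_cramer], of ?L]
          by (simp add: matrix_id_mat_1)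
        then have "det (matrix (cramer ?L)) * det (matrix ?L) = 1"
          by (metis det_mul det_I)
        then show ?thesis using g_orientation[OF d u] zero_less_mult_iff[of "det (matrix (cramer ?L))" "det (matrix ?L)"] by auto
      qed
      ultimately show ?thesis by simp
    qed
    then show ?thesis using sm by (simp add: oriented_transition_def Let_def)
  qed
  show ?thesis using ch 1 2 by (simp add: oriented_chart_def)
qed

text \<open>The chart is the restriction of \<open>g\<close> to the preimage of the half disc, on
  which the extended function agrees with the original one.\<close>

lemma local_graph_chart:
  assumes lam: "\<And>c. c \<in> A \<Longrightarrow> smooth_on (chart_image c) (local_rep lam c)"
  obtains U l where "p \<in> U" "oriented_chart A (U, g)" "smooth_on UNIV l"
    "\<And>q. q \<in> U \<Longrightarrow> l (g q) = (lam q :: real)"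
proof -
  obtain r U \<sigma> where r: "r > 0" and U: "open U" "p \<in> U" and \<sigma>: "homeomorphism U (ball (g p) r) g \<sigma>"
    using local_section by blast
  obtain l where l: "smooth_on UNIV l" "\<And>y. y \<in> ball (g p) (r / 2) \<Longrightarrow> l y = (lam \<circ> \<sigma>) y"
    using smooth_extension_from_ball[OF smooth_in_section[OF U(1) open_ball \<sigma> lam] r] by blast
  let ?B = "ball (g p) (r / 2)"
  let ?U = "U \<inter> g -` ?B"
  have oU: "open ?U" by (intro continuous_open_preimage g_continuous U) auto
  have \<sigma>': "homeomorphism ?U ?B g \<sigma>"
    by (rule homeomorphismI)
      (use \<sigma> r in \<open>auto simp: homeomorphism_def intro!: g_continuous intro: continuous_on_subset\<close>)
  show ?thesis
  proof (rule that)
    show "p \<in> ?U" using U r by auto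
    show "oriented_chart A (?U, g)" by (rule section_oriented_chart[OF oU open_ball \<sigma>'])
    show "l (g q) = lam q" if "q \<in> ?U" for q
      using that l(2)[of "g q"] \<sigma> by (auto simp: homeomorphism_def)
  qed (rule l(1))
qed

section \<open>Unique lifting and the lengths of curves\<close>

text \<open>Two lifts agree on an open set because \<open>g\<close> is locally injective, and on a
  closed set because the surface is Hausdorff.\<close>

lemma unique_lift:
  fixes \<phi> \<psi> :: "'b::topological_space \<Rightarrow> 'a"
  assumes S: "connected S" and \<phi>: "continuous_on S \<phi>" and \<psi>: "continuous_on S \<psi>"
    and eq: "\<And>s. s \<in> S \<Longrightarrow> g (\<phi> s) = g (\<psi> s)"
    and s0: "s0 \<in> S" "\<phi> s0 = \<psi> s0" and s: "s \<in> S"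
  shows "\<phi> s = \<psi> s"
proof -
  have "(\<phi> s = \<psi> s) = (\<phi> s0 = \<psi> s0)"
  proof (rule connected_local_const[OF S s s0(1)], intro ballI)
    fix a assume a: "a \<in> S"
    have "(\<phi> \<longlongrightarrow> \<phi> a) (at a within S)" "(\<psi> \<longlongrightarrow> \<psi> a) (at a within S)"
      using \<phi> \<psi> a by (auto simp: continuous_on_def)
    note near = topological_tendstoD[OF this(1)] and near' = topological_tendstoD[OF this(2)]
    have inS: "\<forall>\<^sub>F b in at a within S. b \<in> S" by (simp add: eventually_at_filter)
    show "\<forall>\<^sub>F b in at a within S. (\<phi> a = \<psi> a) = (\<phi> b = \<psi> b)"
    proof (cases "\<phi> a = \<psi> a")
      case True
      obtain r U \<sigma> where U: "open U" "\<phi> a \<in> U" and \<sigma>: "homeomorphism U (ball (g (\<phi> a)) r) g \<sigma>"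
        by (rule local_section[of "\<phi> a"])
      have inj: "x = y" if "x \<in> U" "y \<in> U" "g x = g y" for x y
        using homeomorphism_apply1[OF \<sigma>] that by metis
      show ?thesis
        using near[OF U] near'[OF U(1) U(2)[unfolded True]] inS
        by eventually_elim (simp add: True inj eq)
    next
      case False
      obtain V W where VW: "open V" "open W" "\<phi> a \<in> V" "\<psi> a \<in> W" "V \<inter> W = {}"
        using hausdorff[OF False] by blast
      show ?thesis
        using near[OF VW(1,3)] near'[OF VW(2,4)]
        by eventually_elim (use False VW(5) in \<open>auto simp: disjoint_iff\<close>)
    qed
  qed
  then show ?thesis using s0(2) by simp
qed

text \<open>Curves described by their image under \<open>g\<close>: \<open>h'\<close> is the
  velocity of the image, continuous outside the finite set \<open>F\<close>, and \<open>L\<close>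
  is the Euclidean length. Curves of this kind are easy to build and to join, since no chart
  occurs.\<close>

definition plane_curve :: "(real \<Rightarrow> 'a) \<Rightarrow> real set \<Rightarrow> (real \<Rightarrow> real^2) \<Rightarrow> real \<Rightarrow> bool" where
  "plane_curve \<gamma> F h' L \<longleftrightarrow>
     path \<gamma> \<and> finite F \<and> continuous_on ({0<..<1} - F) h' \<and>
     (\<forall>t\<in>{0<..<1} - F. ((g \<circ> \<gamma>) has_vector_derivative h' t) (at t)) \<and>
     ((\<lambda>t. norm (h' t)) has_integral L) {0..1}"

definition joined :: "'a \<Rightarrow> 'a \<Rightarrow> bool" where
  "joined p q \<longleftrightarrow>
     (\<exists>\<gamma> F h' L. plane_curve \<gamma> F h' L \<and> pathstart \<gamma> = p \<and> pathfinish \<gamma> = q)"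

lemma path_preimage_open:
  assumes "path \<gamma>" "open U"
  shows "open ({0<..<1} \<inter> \<gamma> -` U)"
proof (rule continuous_open_preimage)
  show "continuous_on {0<..<1} \<gamma>" using assms(1) unfolding path_def
    by (rule continuous_on_subset) auto
qed (use assms in auto)

lemma chart_velocity:
  fixes h :: "'a \<Rightarrow> 'b::euclidean_space"
  assumes h: "smooth_on (chart_image c) (local_rep h c)" and c: "c \<in> A"
    and \<gamma>: "path \<gamma>" "t \<in> {0<..<1}" "\<gamma> t \<in> fst c"
    and D: "((snd c \<circ> \<gamma>) has_vector_derivative D) (at t)"
  shows "((h \<circ> \<gamma>) has_vector_derivative differential h c (snd c (\<gamma> t)) D) (at t)"
proof -
  have "(local_rep h c has_derivative differential h c (snd c (\<gamma> t))) (at ((snd c \<circ> \<gamma>) t))"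
    using differential_linear(2)[OF h] \<gamma>(3) by auto
  then have "((local_rep h c \<circ> (snd c \<circ> \<gamma>)) has_vector_derivative differential h c (snd c (\<gamma> t)) D) (at t)"
    by (rule vector_derivative_diff_chain_within[OF D has_derivative_at_withinI])
  then show ?thesis
    by (rule has_vector_derivative_transform_within_open[OF _ path_preimage_open[OF \<gamma>(1) chart(1)[OF c]]])
      (use \<gamma> chart(7)[OF c] in \<open>auto simp: local_rep_def\<close>)
qed

text \<open>In a chart both velocities are images of the same coordinate velocity, and
  \<open>g\<close> is isometric.\<close>

lemma speed_eq:
  assumes c: "c \<in> A" and \<gamma>: "path \<gamma>" "t \<in> {0<..<1}" "\<gamma> t \<in> fst c"
    and D: "((snd c \<circ> \<gamma>) has_vector_derivative D) (at t)"
  shows "((g \<circ> \<gamma>) has_vector_derivative vector_derivative (g \<circ> \<gamma>) (at t)) (at t)"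
    and "(let v = vector_derivative (f \<circ> \<gamma>) (at t) in sqrt (mink v v)) =
         norm (vector_derivative (g \<circ> \<gamma>) (at t))"
proof -
  have f: "vector_derivative (f \<circ> \<gamma>) (at t) = differential f c (snd c (\<gamma> t)) D"
    by (rule vector_derivative_at[OF chart_velocity[OF f_smooth[OF c] assms]])
  note g = chart_velocity[OF g_smooth[OF c] assms]
  show "((g \<circ> \<gamma>) has_vector_derivative vector_derivative (g \<circ> \<gamma>) (at t)) (at t)"
    unfolding vector_derivative_at[OF g] by (rule g)
  have "snd c (\<gamma> t) \<in> chart_image c" using \<gamma> by auto
  then show "(let v = vector_derivative (f \<circ> \<gamma>) (at t) in sqrt (mink v v)) =
         norm (vector_derivative (g \<circ> \<gamma>) (at t))"
    using g_isometric[OF c, of "snd c (\<gamma> t)" D D]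
    by (simp add: f vector_derivative_at[OF g] norm_eq_sqrt_inner induced_metric_def Let_def)
qed

lemma piecewise_C1_curve_velocity:
  assumes "piecewise_C1_curve A \<gamma>"
  obtains F where "finite F"
    "\<And>t. t \<in> {0<..<1} - F \<Longrightarrow>
       ((g \<circ> \<gamma>) has_vector_derivative vector_derivative (g \<circ> \<gamma>) (at t)) (at t)"
    "\<And>t. t \<in> {0<..<1} - F \<Longrightarrow>
      (let v = vector_derivative (f \<circ> \<gamma>) (at t) in sqrt (mink v v)) =
         norm (vector_derivative (g \<circ> \<gamma>) (at t))"
proof -
  obtain F where F: "finite F" and C1: "\<And>c. c \<in> A \<Longrightarrow>
       (snd c \<circ> \<gamma>) C1_differentiable_on {t \<in> {0<..<1} - F. \<gamma> t \<in> fst c}" and \<gamma>: "path \<gamma>"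
    using assms unfolding piecewise_C1_curve_def by blast
  have "((g \<circ> \<gamma>) has_vector_derivative vector_derivative (g \<circ> \<gamma>) (at t)) (at t) \<and>
    (let v = vector_derivative (f \<circ> \<gamma>) (at t) in sqrt (mink v v)) =
         norm (vector_derivative (g \<circ> \<gamma>) (at t))"
    if t: "t \<in> {0<..<1} - F" for t
  proof -
    obtain c where c: "c \<in> A" "\<gamma> t \<in> fst c" using oriented_atlasD(2)[OF A] by blast
    obtain D where D: "((snd c \<circ> \<gamma>) has_vector_derivative D) (at t)"
      using C1[OF c(1)] t c(2) unfolding C1_differentiable_on_def by blast
    show ?thesis using speed_eq[OF c(1) \<gamma> _ c(2) D] t by auto
  qed
  then show ?thesis using that F by blast
qed

text \<open>The displacement of the image is the integral of its velocity, whose norm is the speed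
  in the induced metric at all but finitely many times.\<close>

lemma dist_le_length:
  assumes \<gamma>: "piecewise_C1_curve A \<gamma>" and L: "has_length f \<gamma> L" and s: "0 \<le> s" "s \<le> 1"
  shows "dist (g (\<gamma> s)) (g (pathfinish \<gamma>)) \<le> L"
proof -
  let ?h = "g \<circ> \<gamma>" and ?h' = "\<lambda>t. vector_derivative (g \<circ> \<gamma>) (at t)"
  obtain F where F: "finite F"
    and der: "\<And>t. t \<in> {0<..<1} - F \<Longrightarrow> (?h has_vector_derivative ?h' t) (at t)"
    and speed: "\<And>t. t \<in> {0<..<1} - F \<Longrightarrow>
      (let v = vector_derivative (f \<circ> \<gamma>) (at t) in sqrt (mink v v)) = norm (?h' t)"
    using piecewise_C1_curve_velocity[OF \<gamma>] by blast
  have p: "path \<gamma>" using \<gamma> by (simp add: piecewise_C1_curve_def)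
  have "((\<lambda>t. norm (?h' t)) has_integral L) {0..1}"
    by (rule has_integral_spike_finite[OF _ _ L[unfolded has_length_def], of "F \<union> {0,1}"])
      (use F speed in auto)
  then have I: "(\<lambda>t. norm (?h' t)) integrable_on {0..1}" "integral {0..1} (\<lambda>t. norm (?h' t)) = L"
    by (auto simp: has_integral_iff)
  have Is: "(\<lambda>t. norm (?h' t)) integrable_on {s..1}"
    by (rule integrable_on_subinterval[OF I(1)]) (use s in auto)
  have "continuous_on {0..1} ?h"
    using p g_continuous unfolding path_def by (intro continuous_on_compose)
  then have "(?h' has_integral (?h 1 - ?h s)) {s..1}"
    by (intro fundamental_theorem_of_calculus_interior_strong[OF F s(2), where f = ?h] der)
      (use s in \<open>auto intro: continuous_on_subset\<close>)
  then have "norm (?h 1 - ?h s) \<le> integral {s..1} (\<lambda>t. norm (?h' t))"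
    using integral_norm_bound_integral[OF _ Is, of ?h'] by (auto simp: has_integral_iff)
  also have "\<dots> \<le> integral {0..1} (\<lambda>t. norm (?h' t))"
    by (rule integral_subset_le) (use s I Is in auto)
  finally show ?thesis by (simp add: I(2) dist_norm norm_minus_commute pathfinish_def)
qed

text \<open>A curve in the surface is as regular as its image in the plane, because the local
  inverses of \<open>g\<close> are smooth.\<close>

lemma plane_curve_C1:
  assumes "plane_curve \<gamma> F h' L"
  shows "piecewise_C1_curve A \<gamma>" "has_length f \<gamma> L"
proof -
  have \<gamma>: "path \<gamma>" and F: "finite F" and h': "continuous_on ({0<..<1} - F) h'"
    and der: "\<And>t. t \<in> {0<..<1} - F \<Longrightarrow> ((g \<circ> \<gamma>) has_vector_derivative h' t) (at t)"
    and L: "((\<lambda>t. norm (h' t)) has_integral L) {0..1}"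
    using assms by (auto simp: plane_curve_def)
  define D where "D c t = cramer (differential g c (snd c (\<gamma> t))) (h' t)" for c t
  have D: "((snd c \<circ> \<gamma>) has_vector_derivative D c t) (at t)"
    if c: "c \<in> A" and t: "t \<in> {0<..<1} - F" "\<gamma> t \<in> fst c" for c t
  proof -
    obtain r U \<sigma> where r: "r > 0" and U: "open U" "\<gamma> t \<in> U"
      and \<sigma>: "homeomorphism U (ball (g (\<gamma> t)) r) g \<sigma>"
      by (rule local_section[of "\<gamma> t"])
    have \<sigma>g: "\<sigma> (g q) = q" if "q \<in> U" for q using homeomorphism_apply1[OF \<sigma> that] .
    have "((snd c \<circ> \<sigma>) has_derivative cramer (differential g c (snd c (\<sigma> (g (\<gamma> t)))))) (at (g (\<gamma> t)))"
      by (rule section_smooth(4)[OF U(1) open_ball \<sigma> c]) (use U t in auto)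
    then have "((snd c \<circ> \<sigma>) has_derivative cramer (differential g c (snd c (\<gamma> t)))) (at ((g \<circ> \<gamma>) t))"
      using \<sigma>g[OF U(2)] by simp
    then have "((snd c \<circ> \<sigma> \<circ> (g \<circ> \<gamma>)) has_vector_derivative D c t) (at t)"
      unfolding D_def
      by (rule vector_derivative_diff_chain_within[OF der[OF t(1)] has_derivative_at_withinI])
    then show ?thesis
      by (rule has_vector_derivative_transform_within_open[OF _ path_preimage_open[OF \<gamma> U(1)]])
        (use U t \<sigma>g in auto)
  qed
  have "(snd c \<circ> \<gamma>) C1_differentiable_on {t \<in> {0<..<1} - F. \<gamma> t \<in> fst c}" (is "_ C1_differentiable_on ?S")
    if c: "c \<in> A" for c
  proof -
    have det: "det (matrix (frechet_derivative (local_rep g c) (at u))) \<noteq> 0" if "u \<in> chart_image c" for u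
      using g_orientation[OF c that] by (simp add: differential_def)
    have cr: "continuous_on (chart_image c) (\<lambda>u. cramer (differential g c u) w)" for w
      using Ck_on_cramer[OF g_smooth[OF c] det, of 0 "\<lambda>_. w"] by (simp add: differential_def)
    have c\<gamma>: "continuous_on ?S \<gamma>"
      using \<gamma> unfolding path_def by (rule continuous_on_subset) auto
    have "continuous_on ?S (\<lambda>t. snd c (\<gamma> t))"
      by (rule continuous_on_compose2[OF chart(3)[OF c] c\<gamma>]) auto
    then have "continuous_on ?S (\<lambda>t. cramer (differential g c (snd c (\<gamma> t))) w)" for w
      by (rule continuous_on_compose2[OF cr]) auto
    moreover have "continuous_on ?S h'" by (rule continuous_on_subset[OF h']) auto
    ultimately have "continuous_on ?S (D c)"
      unfolding D_def linear_on_plane[OF bounded_linear.linear[OF bounded_linear_cramer], of _ "h' _"]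
      by (intro continuous_intros)
    then show ?thesis
      unfolding C1_differentiable_on_def using D[OF c] by (intro exI[of _ "D c"]) auto
  qed
  then show "piecewise_C1_curve A \<gamma>" using \<gamma> F unfolding piecewise_C1_curve_def by blast
  have "(let v = vector_derivative (f \<circ> \<gamma>) (at t) in sqrt (mink v v)) = norm (h' t)"
    if t: "t \<in> {0<..<1} - F" for t
  proof -
    obtain c where c: "c \<in> A" "\<gamma> t \<in> fst c" using oriented_atlasD(2)[OF A] by blast
    show ?thesis
      using speed_eq(2)[OF c(1) \<gamma> _ c(2) D[OF c(1) t c(2)]] t vector_derivative_at[OF der[OF t]] by auto
  qed
  then show "has_length f \<gamma> L"
    unfolding has_length_def
    by (intro has_integral_spike_finite[OF _ _ L, of "F \<union> {0,1}"]) (use F in auto)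
qed

lemma segment_plane_curve:
  assumes \<sigma>: "continuous_on C \<sigma>" "\<And>y. y \<in> C \<Longrightarrow> g (\<sigma> y) = y" and C: "closed_segment y z \<subseteq> C"
  shows "plane_curve (\<sigma> \<circ> linepath y z) {} (\<lambda>_. z - y) (dist y z)"
proof -
  have im: "linepath y z t \<in> C" if "t \<in> {0..1}" for t
    using C that by (auto simp: linepath_in_path)
  have "path (\<sigma> \<circ> linepath y z)"
    unfolding path_def
    by (intro continuous_on_compose continuous_on_linepath continuous_on_subset[OF \<sigma>(1)]) (use im in auto)
  moreover have "((g \<circ> (\<sigma> \<circ> linepath y z)) has_vector_derivative z - y) (at t)" if t: "t \<in> {0<..<1}" for t
    by (rule has_vector_derivative_transform_within_open[OF has_vector_derivative_linepath_within _ t])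
      (use im \<sigma>(2) in auto)
  moreover have "((\<lambda>t. norm (z - y)) has_integral dist y z) {0..1::real}"
    using has_integral_const_real[of "norm (z - y)" 0 1] by (simp add: dist_norm norm_minus_commute)
  ultimately show ?thesis by (simp add: plane_curve_def)
qed

text \<open>The two curves are run through at double speed. The new exceptional set contains the
  two rescaled ones and the midpoint.\<close>

lemma joined_trans:
  assumes "joined p q" "joined q s"
  shows "joined p s"
proof -
  obtain \<gamma>1 F1 h1 L1 where 1: "plane_curve \<gamma>1 F1 h1 L1" "pathstart \<gamma>1 = p" "pathfinish \<gamma>1 = q"
    using assms(1) by (auto simp: joined_def)
  obtain \<gamma>2 F2 h2 L2 where 2: "plane_curve \<gamma>2 F2 h2 L2" "pathstart \<gamma>2 = q" "pathfinish \<gamma>2 = s"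
    using assms(2) by (auto simp: joined_def)
  let ?\<gamma> = "\<gamma>1 +++ \<gamma>2"
  define F where "F = insert (1/2) ((\<lambda>x. x / 2) ` F1 \<union> (\<lambda>x. (x + 1) / 2) ` F2)"
  define h' where "h' t = (if t < 1/2 then 2 *\<^sub>R h1 (2 * t) else 2 *\<^sub>R h2 (2 * t - 1))" for t
  have t1: "2 * t \<in> {0<..<1} - F1" if "t \<in> {0<..<1} - F" "t < 1/2" for t
  proof -
    have "2 * t \<notin> F1"
    proof
      assume "2 * t \<in> F1"
      then have "(2 * t) / 2 \<in> F" unfolding F_def by blast
      then show False using that by simp
    qed
    then show ?thesis using that by auto
  qed
  have t2: "2 * t - 1 \<in> {0<..<1} - F2" if "t \<in> {0<..<1} - F" "\<not> t < 1/2" for t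
  proof -
    have "t \<noteq> 1/2" using that by (auto simp: F_def)
    have "2 * t - 1 \<notin> F2"
    proof
      assume "2 * t - 1 \<in> F2"
      then have "((2 * t - 1) + 1) / 2 \<in> F" unfolding F_def by blast
      then show False using that by simp
    qed
    then show ?thesis using that \<open>t \<noteq> 1/2\<close> by auto
  qed
  have "plane_curve ?\<gamma> F h' (L1 + L2)"
    unfolding plane_curve_def
  proof (intro conjI ballI)
    show "path ?\<gamma>" using 1 2 by (intro path_join_imp) (auto simp: plane_curve_def)
    show "finite F" using 1 2 by (auto simp: plane_curve_def F_def)
    show "((g \<circ> ?\<gamma>) has_vector_derivative h' t) (at t)" if t: "t \<in> {0<..<1} - F" for t
    proof (cases "t < 1/2")
      case True
      have "((g \<circ> \<gamma>1) has_vector_derivative h1 (2 * t)) (at (2 * t))"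
        using 1(1) t1[OF t True] by (simp add: plane_curve_def)
      moreover have "((\<lambda>t. 2 * t) has_vector_derivative (2::real)) (at t)"
        by (auto intro!: derivative_eq_intros)
      ultimately have "((g \<circ> \<gamma>1) \<circ> (\<lambda>t. 2 * t) has_vector_derivative 2 *\<^sub>R h1 (2 * t)) (at t)"
        by (intro vector_diff_chain_at)
      then have "((g \<circ> \<gamma>1) \<circ> (\<lambda>t. 2 * t) has_vector_derivative h' t) (at t)"
        using True by (simp add: h'_def)
      then show ?thesis
        by (rule has_vector_derivative_transform_within_open[of _ _ _ "{..<1/2}"])
          (use True in \<open>auto simp: joinpaths_def\<close>)
    next
      case False
      have "((g \<circ> \<gamma>2) has_vector_derivative h2 (2 * t - 1)) (at (2 * t - 1))"
        using 2(1) t2[OF t False] by (simp add: plane_curve_def)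
      moreover have "((\<lambda>t. 2 * t - 1) has_vector_derivative (2::real)) (at t)"
        by (auto intro!: derivative_eq_intros)
      ultimately have "((g \<circ> \<gamma>2) \<circ> (\<lambda>t. 2 * t - 1) has_vector_derivative 2 *\<^sub>R h2 (2 * t - 1)) (at t)"
        by (intro vector_diff_chain_at)
      then have "((g \<circ> \<gamma>2) \<circ> (\<lambda>t. 2 * t - 1) has_vector_derivative h' t) (at t)"
        using False by (simp add: h'_def)
      then show ?thesis
        by (rule has_vector_derivative_transform_within_open[of _ _ _ "{1/2<..}"])
          (use False t in \<open>auto simp: joinpaths_def F_def\<close>)
    qed
    show "continuous_on ({0<..<1} - F) h'"
    proof -
      have oF: "open ({0<..<1} - F)"
        using 1 2 by (intro open_Diff finite_imp_closed) (auto simp: plane_curve_def F_def)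
      let ?S1 = "({0<..<1} - F) \<inter> {..<1/2}" and ?S2 = "({0<..<1} - F) \<inter> {1/2<..}"
      have "continuous_on ({0<..<1} - F1) h1" "continuous_on ({0<..<1} - F2) h2"
        using 1(1) 2(1) by (auto simp: plane_curve_def)
      note h = continuous_on_compose2[OF this(1)] continuous_on_compose2[OF this(2)]
      have "continuous_on ?S1 (\<lambda>t. h1 (2 * t))"
        by (rule h(1)) (use t1 in \<open>auto intro!: continuous_intros\<close>)
      then have "continuous_on ?S1 (\<lambda>t. 2 *\<^sub>R h1 (2 * t))"
        by (rule continuous_on_scaleR[OF continuous_on_const])
      then have c1: "continuous_on ?S1 h'"
        by (rule continuous_on_cong[THEN iffD1, rotated -1]) (auto simp: h'_def)
      have "continuous_on ?S2 (\<lambda>t. h2 (2 * t - 1))"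
        by (rule h(2)) (use t2 in \<open>auto intro!: continuous_intros\<close>)
      then have "continuous_on ?S2 (\<lambda>t. 2 *\<^sub>R h2 (2 * t - 1))"
        by (rule continuous_on_scaleR[OF continuous_on_const])
      then have c2: "continuous_on ?S2 h'"
        by (rule continuous_on_cong[THEN iffD1, rotated -1]) (auto simp: h'_def)
      have "continuous_on (?S1 \<union> ?S2) h'"
        using oF by (intro continuous_on_open_Un c1 c2) auto
      moreover have "?S1 \<union> ?S2 = {0<..<1} - F"
        by (auto simp: F_def)
      ultimately show ?thesis by simp
    qed
    have I1: "((\<lambda>t. norm (h1 t)) has_integral L1) (cbox 0 1)"
      and I2: "((\<lambda>t. norm (h2 t)) has_integral L2) (cbox 0 1)"
      using 1 2 by (auto simp: plane_curve_def)
    have J1: "((\<lambda>t. norm (h1 (2 * t))) has_integral (L1 / 2)) {0..1/2}"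
      using has_integral_affinity_iff[of 2 "\<lambda>t. norm (h1 t)" 0 L1 0 1] I1
      by simp
    have J2: "((\<lambda>t. norm (h2 (2 * t - 1))) has_integral (L2 / 2)) {1/2..1}"
      using has_integral_affinity_iff[of 2 "\<lambda>t. norm (h2 t)" "-1" L2 0 1] I2
      by simp
    have K1: "((\<lambda>t. norm (h' t)) has_integral L1) {0..1/2}"
      by (rule has_integral_spike_finite[OF _ _ has_integral_mult_right[OF J1, of 2, simplified], of "{1/2}"])
        (auto simp: h'_def)
    have K2: "((\<lambda>t. norm (h' t)) has_integral L2) {1/2..1}"
      by (rule has_integral_spike_finite[OF _ _ has_integral_mult_right[OF J2, of 2, simplified], of "{1/2}"])
        (auto simp: h'_def)
    show "((\<lambda>t. norm (h' t)) has_integral (L1 + L2)) {0..1}"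
      by (rule has_integral_combine[OF _ _ K1 K2]) auto
  qed
  moreover have "pathstart ?\<gamma> = p" "pathfinish ?\<gamma> = s" using 1 2 by auto
  ultimately show ?thesis unfolding joined_def by blast
qed

text \<open>Any two points have a curve of finite length between them. This matters because the
  distance is an infimum over the lengths of curves, whose value for the empty set would say
  nothing about the points.\<close>

lemma joined_if_connected:
  assumes conn: "connected (UNIV :: 'a set)"
  shows "joined p q"
proof -
  have near: "joined a b \<and> joined b a"
    if \<sigma>: "homeomorphism U (ball (g x) r) g \<sigma>" and ab: "a \<in> U" "b \<in> U" for U x r \<sigma> a b
  proof -
    let ?B = "ball (g x) r"
    have \<sigma>': "continuous_on ?B \<sigma>" "\<And>y. y \<in> ?B \<Longrightarrow> g (\<sigma> y) = y" "g a \<in> ?B" "g b \<in> ?B"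
      "\<sigma> (g a) = a" "\<sigma> (g b) = b"
      using \<sigma> ab unfolding homeomorphism_def by blast+
    have s: "closed_segment (g a) (g b) \<subseteq> ?B" "closed_segment (g b) (g a) \<subseteq> ?B"
      by (intro closed_segment_subset convex_ball \<sigma>')+
    have st: "pathstart (\<sigma> \<circ> linepath y z) = \<sigma> y" "pathfinish (\<sigma> \<circ> linepath y z) = \<sigma> z" for y z
      by (simp_all add: pathstart_def pathfinish_def linepath_def)
    show ?thesis
      unfolding joined_def
      using segment_plane_curve[OF \<sigma>'(1,2) s(1)] segment_plane_curve[OF \<sigma>'(1,2) s(2)] st \<sigma>'(5,6)
      by metis
  qed
  have "joined p q = joined p p"
  proof (rule connected_local_const[OF conn UNIV_I UNIV_I], intro ballI)
    fix a
    obtain r U \<sigma> where r: "r > 0" and U: "open U" "a \<in> U" and \<sigma>: "homeomorphism U (ball (g a) r) g \<sigma>"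
      by (rule local_section[of a])
    have "joined p a = joined p b" if "b \<in> U" for b
      using near[OF \<sigma> U(2) that] joined_trans by blast
    then show "\<forall>\<^sub>F b in at a within UNIV. joined p a = joined p b"
      unfolding eventually_at_topological using U by blast
  qed
  moreover have "joined p p"
  proof -
    obtain r U \<sigma> where "p \<in> U" "homeomorphism U (ball (g p) r) g \<sigma>"
      by (rule local_section[of p])
    then show ?thesis using near by blast
  qed
  ultimately show ?thesis by simp
qed

abbreviation curve_lengths :: "'a \<Rightarrow> 'a \<Rightarrow> real set" where
  "curve_lengths p q \<equiv>
     {L. \<exists>\<gamma>. piecewise_C1_curve A \<gamma> \<and> pathstart \<gamma> = p \<and> pathfinish \<gamma> = q \<and> has_length f \<gamma> L}"

lemma riemannian_dist_le:
  assumes "plane_curve \<gamma> F h' L"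
  shows "riemannian_dist A f (pathstart \<gamma>) (pathfinish \<gamma>) \<le> L"
proof -
  have "bdd_below (curve_lengths (pathstart \<gamma>) (pathfinish \<gamma>))"
  proof (rule bdd_belowI[of _ 0])
    fix L assume "L \<in> curve_lengths (pathstart \<gamma>) (pathfinish \<gamma>)"
    then obtain \<gamma> where "piecewise_C1_curve A \<gamma>" "has_length f \<gamma> L" by blast
    from dist_le_length[OF this, of 1] show "0 \<le> L" by (simp add: pathfinish_def)
  qed
  then show ?thesis
    unfolding riemannian_dist_def using plane_curve_C1[OF assms] by (intro cInf_lower) auto
qed

lemma riemannian_dist_lessD:
  assumes conn: "connected (UNIV :: 'a set)" and d: "riemannian_dist A f p q < \<epsilon>"
  obtains \<gamma> L where "piecewise_C1_curve A \<gamma>" "pathstart \<gamma> = p" "pathfinish \<gamma> = q"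
    "has_length f \<gamma> L" "L < \<epsilon>"
proof -
  have "curve_lengths p q \<noteq> {}"
    using joined_if_connected[OF conn, of p q] plane_curve_C1 unfolding joined_def by blast
  from cInf_lessD[OF this d[unfolded riemannian_dist_def]] show ?thesis using that by blast
qed

text \<open>A curve of length less than \<open>\<rho>\<close> that ends in \<open>q\<close> has
  its image in the disc around \<open>g q\<close>, so it is the lift of its image by
  \<open>\<theta>\<close>. Closeness in the Riemannian distance thus implies closeness in the
  surface.\<close>

lemma riemannian_ball_in_section:
  assumes conn: "connected (UNIV :: 'a set)"
    and \<theta>: "homeomorphism U (ball (g q) \<rho>) g \<theta>" and q: "q \<in> U"
    and d: "riemannian_dist A f s q < \<epsilon>" and \<epsilon>: "\<epsilon> \<le> \<rho>"
  shows "dist (g s) (g q) < \<epsilon>" "\<theta> (g s) = s"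
proof -
  obtain \<gamma> L where \<gamma>: "piecewise_C1_curve A \<gamma>" "pathstart \<gamma> = s" "pathfinish \<gamma> = q"
    "has_length f \<gamma> L" "L < \<epsilon>"
    using riemannian_dist_lessD[OF conn d] .
  have b: "dist (g (\<gamma> t)) (g q) < \<epsilon>" if "t \<in> {0..1}" for t
    using dist_le_length[OF \<gamma>(1,4), of t] that \<gamma>(3,5) by simp
  show "dist (g s) (g q) < \<epsilon>" using b[of 0] \<gamma>(2) by (simp add: pathstart_def)
  have c\<gamma>: "continuous_on {0..1} \<gamma>" using \<gamma>(1) by (simp add: piecewise_C1_curve_def path_def)
  have inB: "g (\<gamma> t) \<in> ball (g q) \<rho>" if "t \<in> {0..1}" for t
    using b[OF that] \<epsilon> by (simp add: dist_commute)
  have c\<theta>: "continuous_on {0..1} (\<lambda>t. \<theta> (g (\<gamma> t)))"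
  proof (rule continuous_on_compose2[of "ball (g q) \<rho>" \<theta>])
    show "continuous_on (ball (g q) \<rho>) \<theta>" using \<theta> by (simp add: homeomorphism_def)
    show "continuous_on {0..1} (\<lambda>t. g (\<gamma> t))"
      by (rule continuous_on_compose2[OF g_continuous[of UNIV] c\<gamma>]) auto
  qed (use inB in auto)
  have "\<theta> (g (\<gamma> 0)) = \<gamma> 0"
  proof (rule unique_lift[OF _ c\<theta> c\<gamma>, of 1])
    show "g (\<theta> (g (\<gamma> t))) = g (\<gamma> t)" if "t \<in> {0..1}" for t
      using homeomorphism_apply2[OF \<theta> inB[OF that]] .
    show "\<theta> (g (\<gamma> 1)) = \<gamma> 1"
      using homeomorphism_apply1[OF \<theta> q] \<gamma>(3) by (simp add: pathfinish_def)
  qed auto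
  then show "\<theta> (g s) = s" using \<gamma>(2) by (simp add: pathstart_def)
qed

end

section \<open>Completeness\<close>

lemma convex_ball_neighbourhood:
  fixes S :: "'a::real_normed_vector set"
  assumes "convex S"
  shows "convex (\<Union>x\<in>S. ball x e)"
proof -
  have "ball x e = (\<Union>y\<in>ball 0 e. {x + y})" for x :: 'a
  proof (intro set_eqI iffI)
    fix z assume "z \<in> ball x e"
    then show "z \<in> (\<Union>y\<in>ball 0 e. {x + y})"
      by (intro UN_I[of "z - x"]) (auto simp: dist_norm norm_minus_commute)
  qed (auto simp: dist_norm)
  then have "(\<Union>x\<in>S. ball x e) = (\<Union>x\<in>S. \<Union>y\<in>ball 0 e. {x + y})"
    by (rule SUP_cong[OF refl])
  then show ?thesis using convex_sums[OF assms convex_ball] by metis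
qed

context flat_development
begin

text \<open>Sections of \<open>g\<close> over convex open sets with a prescribed value at \<open>g
  p\<close>. Two convex sets that contain \<open>g p\<close> have a connected intersection, so
  such sections always agree where both are defined.\<close>

definition section_from :: "'a \<Rightarrow> (real^2) set \<Rightarrow> (real^2 \<Rightarrow> 'a) \<Rightarrow> bool" where
  "section_from p W \<tau> \<longleftrightarrow>
     open W \<and> convex W \<and> g p \<in> W \<and> continuous_on W \<tau> \<and> \<tau> (g p) = p \<and> (\<forall>y\<in>W. g (\<tau> y) = y)"

lemma section_from_unique:
  assumes "section_from p W \<tau>" "section_from p W' \<tau>'" "y \<in> W" "y \<in> W'"
  shows "\<tau> y = \<tau>' y"
proof (rule unique_lift[of "W \<inter> W'" \<tau> \<tau>' "g p"])
  show "connected (W \<inter> W')"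
    using assms by (auto simp: section_from_def intro!: convex_connected convex_Int)
  show "continuous_on (W \<inter> W') \<tau>" "continuous_on (W \<inter> W') \<tau>'"
    using assms by (auto simp: section_from_def intro: continuous_on_subset)
qed (use assms in \<open>auto simp: section_from_def\<close>)

lemma section_from_segment:
  assumes W: "section_from p W \<tau>" and yz: "y \<in> W" "z \<in> W"
  shows "riemannian_dist A f (\<tau> y) (\<tau> z) \<le> dist y z"
proof -
  have "closed_segment y z \<subseteq> W"
    using W yz by (intro closed_segment_subset) (auto simp: section_from_def)
  then have "plane_curve (\<tau> \<circ> linepath y z) {} (\<lambda>_. z - y) (dist y z)"
    using W by (intro segment_plane_curve[of W]) (auto simp: section_from_def)
  from riemannian_dist_le[OF this] show ?thesis
    by (simp add: pathstart_def pathfinish_def linepath_def)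
qed

text \<open>The union of \<open>W\<close> with the disc need not be convex, but it contains the
  segment from \<open>g p\<close> to \<open>y\<close>, and a sufficiently small neighbourhood of
  this segment is a convex open subset.\<close>

lemma extend_section:
  assumes W: "section_from p W \<tau>" and \<theta>: "homeomorphism U (ball y \<rho>) g \<theta>"
    and x: "x \<in> W" "x \<in> ball y \<rho>" "\<theta> x = \<tau> x" and seg: "x \<in> closed_segment (g p) y"
  obtains V \<kappa> where "section_from p V \<kappa>" "y \<in> V"
proof -
  have W': "open W" "convex W" "g p \<in> W" "continuous_on W \<tau>" "\<tau> (g p) = p"
    "\<And>z. z \<in> W \<Longrightarrow> g (\<tau> z) = z"
    using W by (auto simp: section_from_def)
  let ?B = "ball y \<rho>"
  have \<theta>': "continuous_on ?B \<theta>" "\<And>z. z \<in> ?B \<Longrightarrow> g (\<theta> z) = z"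
    using \<theta> by (auto simp: homeomorphism_def)
  have agree: "\<tau> z = \<theta> z" if "z \<in> W \<inter> ?B" for z
  proof (rule unique_lift[of "W \<inter> ?B" \<tau> \<theta> x])
    show "connected (W \<inter> ?B)" using W'(2) by (intro convex_connected convex_Int convex_ball)
    show "continuous_on (W \<inter> ?B) \<tau>" "continuous_on (W \<inter> ?B) \<theta>"
      using W'(4) \<theta>'(1) by (auto intro: continuous_on_subset)
  qed (use x that W' \<theta>' in auto)
  define \<kappa> where "\<kappa> z = (if z \<in> W then \<tau> z else \<theta> z)" for z
  have "continuous_on W \<kappa>"
    by (rule continuous_on_cong[THEN iffD1, OF refl _ W'(4)]) (simp add: \<kappa>_def)
  moreover have "continuous_on ?B \<kappa>"
    by (rule continuous_on_cong[THEN iffD1, OF refl _ \<theta>'(1)]) (use agree in \<open>auto simp: \<kappa>_def\<close>)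
  ultimately have c\<kappa>: "continuous_on (W \<union> ?B) \<kappa>"
    using W'(1) by (intro continuous_on_open_Un) auto
  have "y \<in> ?B" using x(2) by (metis centre_in_ball ball_eq_empty empty_iff not_le)
  have "closed_segment (g p) x \<subseteq> W" "closed_segment x y \<subseteq> ?B"
    using W' x \<open>y \<in> ?B\<close> by (intro closed_segment_subset convex_ball; blast)+
  then have S: "closed_segment (g p) y \<subseteq> W \<union> ?B"
    using Un_closed_segment[OF seg] by blast
  obtain e where e: "e > 0" "(\<Union>x\<in>closed_segment (g p) y. ball x e) \<subseteq> W \<union> ?B"
    using compact_subset_open_imp_ball_epsilon_subset[OF compact_segment _ S] W'(1) by auto
  let ?V = "\<Union>x\<in>closed_segment (g p) y. ball x e"
  have "section_from p ?V \<kappa>"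
    unfolding section_from_def
  proof (intro conjI ballI)
    show "open ?V" by blast
    show "convex ?V" by (intro convex_ball_neighbourhood convex_closed_segment)
    show "g p \<in> ?V" using e(1) by force
    show "continuous_on ?V \<kappa>" by (rule continuous_on_subset[OF c\<kappa> e(2)])
    show "\<kappa> (g p) = p" using W' by (simp add: \<kappa>_def)
    show "g (\<kappa> z) = z" if "z \<in> ?V" for z
    proof -
      have "z \<in> W \<union> ?B" using that e(2) by blast
      then show ?thesis using W'(6) \<theta>'(2) unfolding \<kappa>_def by auto
    qed
  qed
  moreover have "y \<in> ?V" using e(1) by force
  ultimately show ?thesis using that by blast
qed

text \<open>If the set \<open>\<Omega>\<close> of reachable points did not contain
  \<open>y\<close>, there would be a first point \<open>x T\<close> outside
  \<open>\<Omega>\<close> on the segment from \<open>g p\<close> to \<open>y\<close>. The lifts of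
  points approaching \<open>x T\<close> form a Cauchy sequence, since sections do not increase
  distances. The section around its limit continues the lift to \<open>x T\<close>, a
  contradiction.\<close>

lemma section_reaches_everywhere:
  assumes conn: "connected (UNIV :: 'a set)" and complete: "complete_surface A f"
  shows "\<exists>W \<tau>. section_from p W \<tau> \<and> y \<in> W"
proof (rule ccontr)
  assume y: "\<not> ?thesis"
  define \<Omega> where "\<Omega> = \<Union>{W. \<exists>\<tau>. section_from p W \<tau>}"
  define x where "x t = g p + t *\<^sub>R (y - g p)" for t
  define N where "N = {0..1} \<inter> x -` (- \<Omega>)"
  have \<Omega>I: "z \<in> \<Omega>" if "section_from p W \<tau>" "z \<in> W" for W \<tau> z
    using that unfolding \<Omega>_def by blast
  have open_\<Omega>: "open \<Omega>" unfolding \<Omega>_def by (rule open_Union) (auto simp: section_from_def)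
  have cx: "continuous_on S x" for S unfolding x_def by (intro continuous_intros)
  have "closed N"
    unfolding N_def by (intro continuous_closed_preimage cx) (use open_\<Omega> in auto)
  then have "compact N" unfolding N_def by (simp add: compact_eq_bounded_closed bounded_Int)
  moreover have "1 \<in> N" using y by (auto simp: N_def \<Omega>_def x_def)
  \<comment> \<open>x T is the first point of the segment that no section reaches\<close>
  ultimately obtain T where T: "T \<in> N" "\<And>t. t \<in> N \<Longrightarrow> T \<le> t"
    using compact_attains_inf[of N] by blast
  obtain r U \<sigma> where r: "r > 0" "p \<in> U" "homeomorphism U (ball (g p) r) g \<sigma>"
    by (rule local_section[of p])
  have "section_from p (ball (g p) r) \<sigma>"
    unfolding section_from_def
  proof (intro conjI ballI)
    show "continuous_on (ball (g p) r) \<sigma>" by (rule homeomorphism_cont2[OF r(3)])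
    show "\<sigma> (g p) = p" by (rule homeomorphism_apply1[OF r(3,2)])
    show "g (\<sigma> z) = z" if "z \<in> ball (g p) r" for z by (rule homeomorphism_apply2[OF r(3) that])
    show "g p \<in> ball (g p) r" using r(1) by simp
  qed (rule open_ball convex_ball)+
  then have "g p \<in> \<Omega>" by (rule \<Omega>I) (use r(1) in simp)
  then have "x 0 \<in> \<Omega>" by (simp add: x_def)
  moreover have T0: "x T \<notin> \<Omega>" "0 \<le> T" "T \<le> 1" using T(1) unfolding N_def by simp_all
  ultimately have "T \<noteq> 0" by metis
  then have T01: "0 < T" "T \<le> 1" using T0 by simp_all
  have less: "x t \<in> \<Omega>" if "0 \<le> t" "t < T" for t
  proof (rule ccontr)
    assume "x t \<notin> \<Omega>"
    then have "t \<in> N" using that T01 by (simp add: N_def)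
    then show False using T(2)[of t] that by simp
  qed
  have seg: "x s \<in> closed_segment (g p) (x t)" if "0 \<le> s" "s \<le> t" for s t
  proof (cases "t = 0")
    case False
    then have "x s = (1 - s / t) *\<^sub>R g p + (s / t) *\<^sub>R x t"
      using that by (simp add: x_def algebra_simps)
    then show ?thesis using that False unfolding in_segment by (intro exI[of _ "s / t"]) auto
  qed (use that in \<open>auto simp: x_def\<close>)
  \<comment> \<open>the common value of all sections defined at z\<close>
  define lift where "lift z = (SOME q. \<exists>W \<tau>. section_from p W \<tau> \<and> z \<in> W \<and> q = \<tau> z)" for z
  have lift_eq: "lift z = \<tau> z" if "section_from p W \<tau>" "z \<in> W" for W \<tau> z
    unfolding lift_def
    by (rule some_equality) (use that section_from_unique in blast)+
  have dist_le: "riemannian_dist A f (lift (x s)) (lift (x t)) \<le> dist (x s) (x t)"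
    if st: "0 \<le> s" "s < T" "0 \<le> t" "t < T" for s t
  proof -
    have "x (max s t) \<in> \<Omega>" by (rule less) (use st in auto)
    then obtain W \<tau> where W: "section_from p W \<tau>" "x (max s t) \<in> W"
      unfolding \<Omega>_def by blast
    have "closed_segment (g p) (x (max s t)) \<subseteq> W"
      using W by (intro closed_segment_subset) (auto simp: section_from_def)
    then have "x s \<in> W" "x t \<in> W" using seg[of s "max s t"] seg[of t "max s t"] st by auto
    then show ?thesis using section_from_segment[OF W(1)] lift_eq[OF W(1)] by simp
  qed
  \<comment> \<open>any sequence in [0, T) that converges to T would do\<close>
  define t where "t n = T * (1 - inverse (real (Suc n)))" for n
  have t: "0 \<le> t n" "t n < T" for n
    using T01 inverse_le_1_iff[of "real (Suc n)"] by (auto simp: t_def field_simps)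
  have "t \<longlonglongrightarrow> T * (1 - 0)"
    unfolding t_def by (intro tendsto_intros LIMSEQ_inverse_real_of_nat)
  then have "(\<lambda>n. x (t n)) \<longlonglongrightarrow> x T"
    unfolding x_def by (intro tendsto_intros) simp
  then have xT: "(\<lambda>n. x (t n)) \<longlonglongrightarrow> x T" .
  define s where "s n = lift (x (t n))" for n
  have "\<forall>\<epsilon>>0. \<exists>M. \<forall>m\<ge>M. \<forall>n\<ge>M. riemannian_dist A f (s m) (s n) < \<epsilon>"
  proof (intro allI impI)
    fix \<epsilon> :: real assume "\<epsilon> > 0"
    then obtain M where "\<And>m n. m \<ge> M \<Longrightarrow> n \<ge> M \<Longrightarrow> dist (x (t m)) (x (t n)) < \<epsilon>"
      using metric_CauchyD[OF LIMSEQ_imp_Cauchy[OF xT]] by blast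
    then show "\<exists>M. \<forall>m\<ge>M. \<forall>n\<ge>M. riemannian_dist A f (s m) (s n) < \<epsilon>"
      using dist_le[OF t t] unfolding s_def by (meson le_less_trans)
  qed
  then obtain q where q: "(\<lambda>n. riemannian_dist A f (s n) q) \<longlonglongrightarrow> 0"
    using complete unfolding complete_surface_def by blast
  obtain \<rho> U \<theta> where \<rho>: "\<rho> > 0" and U: "q \<in> U" and \<theta>: "homeomorphism U (ball (g q) \<rho>) g \<theta>"
    by (rule local_section[of q])
  have gs: "g (s n) = x (t n)" for n
  proof -
    obtain W \<tau> where W: "section_from p W \<tau>" "x (t n) \<in> W"
      using less[OF t, of n] unfolding \<Omega>_def by blast
    then show ?thesis using lift_eq[OF W] by (simp add: s_def section_from_def)
  qed
  have ev: "\<forall>\<^sub>F n in sequentially. riemannian_dist A f (s n) q < \<epsilon>" if "\<epsilon> > 0" for \<epsilon>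
    using order_tendstoD(2)[OF q that] .
  have "(\<lambda>n. x (t n)) \<longlonglongrightarrow> g q"
  proof (rule tendstoI)
    fix e :: real assume "e > 0"
    then have m: "min e \<rho> > 0" using \<rho> by simp
    show "\<forall>\<^sub>F n in sequentially. dist (x (t n)) (g q) < e"
      using ev[OF m]
    proof eventually_elim
      case (elim n)
      from riemannian_ball_in_section(1)[OF conn \<theta> U elim] show ?case by (simp add: gs)
    qed
  qed
  then have gq: "g q = x T" using xT LIMSEQ_unique by blast
  obtain n where n: "riemannian_dist A f (s n) q < \<rho>"
    using eventually_happens[OF ev[OF \<rho>]] by auto
  note near = riemannian_ball_in_section[OF conn \<theta> U n order_refl]
  obtain W \<tau> where W: "section_from p W \<tau>" "x (t n) \<in> W"
    using less[OF t, of n] unfolding \<Omega>_def by blast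
  obtain V \<kappa> where V: "section_from p V \<kappa>" "x T \<in> V"
  proof (rule extend_section[OF W(1) \<theta>[unfolded gq] W(2)])
    show "x (t n) \<in> ball (x T) \<rho>" using near(1) by (simp add: gs gq dist_commute)
    show "\<theta> (x (t n)) = \<tau> (x (t n))" using near(2)[unfolded gs] lift_eq[OF W] by (simp add: s_def)
    show "x (t n) \<in> closed_segment (g p) (x T)" using seg t less_imp_le by blast
  qed
  then have "x T \<in> \<Omega>" by (rule \<Omega>I)
  then show False using T0(1) by simp
qed

lemma global_section:
  assumes conn: "connected (UNIV :: 'a set)" and complete: "complete_surface A f"
  obtains \<sigma> where "continuous_on UNIV \<sigma>" "\<And>y. g (\<sigma> y) = y" "\<sigma> (g p) = p"
proof -
  obtain W \<tau> where W: "\<And>y. section_from p (W y) (\<tau> y) \<and> y \<in> W y"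
    using section_reaches_everywhere[OF assms, of p] by metis
  define \<sigma> where "\<sigma> y = \<tau> y y" for y
  have \<sigma>: "\<sigma> z = \<tau> y z" if "z \<in> W y" for y z
    using section_from_unique[of p "W z" "\<tau> z" "W y" "\<tau> y" z] W that by (simp add: \<sigma>_def)
  show ?thesis
  proof
    have "continuous_on (W y) \<sigma>" for y
    proof (rule continuous_on_cong[THEN iffD1, OF refl])
      show "continuous_on (W y) (\<tau> y)" using W[of y] by (simp add: section_from_def)
    qed (simp add: \<sigma>)
    moreover have "open (W y)" for y using W[of y] by (simp add: section_from_def)
    ultimately have "continuous_on (\<Union>y\<in>UNIV. W y) \<sigma>" by (intro continuous_on_open_UN)
    moreover have "(\<Union>y\<in>UNIV. W y) = UNIV" using W by blast
    ultimately show "continuous_on UNIV \<sigma>" by simp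
    show "g (\<sigma> y) = y" for y using W[of y] by (simp add: section_from_def \<sigma>_def)
    show "\<sigma> (g p) = p" using W[of "g p"] by (simp add: section_from_def \<sigma>_def)
  qed
qed

text \<open>The set of points \<open>q\<close> with \<open>\<sigma> (g q) = q\<close> is open and
  closed: near each point, \<open>\<sigma>\<close> and the local section either agree everywhere
  or nowhere.\<close>

lemma complete_imp_homeomorphism:
  assumes conn: "connected (UNIV :: 'a set)" and complete: "complete_surface A f"
  obtains \<sigma> where "homeomorphism UNIV UNIV g \<sigma>"
proof -
  obtain \<sigma> where \<sigma>: "continuous_on UNIV \<sigma>" "\<And>y. g (\<sigma> y) = y" and p: "\<sigma> (g undefined) = undefined"
    using global_section[OF assms, of undefined] by blast
  have "(\<sigma> (g q) = q) = (\<sigma> (g undefined) = undefined)" for q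
  proof (rule connected_local_const[OF conn UNIV_I UNIV_I], intro ballI)
    fix a
    obtain r U \<theta> where r: "r > 0" and U: "open U" "a \<in> U" and \<theta>: "homeomorphism U (ball (g a) r) g \<theta>"
      by (rule local_section[of a])
    let ?B = "ball (g a) r"
    have \<theta>': "continuous_on ?B \<theta>" "\<And>z. z \<in> ?B \<Longrightarrow> g (\<theta> z) = z"
      "\<And>b. b \<in> U \<Longrightarrow> \<theta> (g b) = b" "\<And>b. b \<in> U \<Longrightarrow> g b \<in> ?B"
      using \<theta> unfolding homeomorphism_def by blast+
    have agree: "\<sigma> (g c) = c" if b: "b \<in> U" "\<sigma> (g b) = b" and c: "c \<in> U" for b c
    proof -
      have "\<sigma> (g c) = \<theta> (g c)"
      proof (rule unique_lift[of ?B \<sigma> \<theta> "g b"])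
        show "connected ?B" by (intro convex_connected convex_ball)
        show "continuous_on ?B \<sigma>" by (rule continuous_on_subset[OF \<sigma>(1)]) auto
      qed (use \<theta>' \<sigma>(2) b c in auto)
      then show ?thesis using \<theta>'(3)[OF c] by simp
    qed
    have "(\<sigma> (g a) = a) = (\<sigma> (g b) = b)" if "b \<in> U" for b
      using agree[OF U(2) _ that] agree[OF that _ U(2)] by blast
    then show "\<forall>\<^sub>F b in at a within UNIV. (\<sigma> (g a) = a) = (\<sigma> (g b) = b)"
      unfolding eventually_at_topological using U by blast
  qed
  then have "\<sigma> (g q) = q" for q using p by blast
  then have "homeomorphism UNIV UNIV g \<sigma>"
    using \<sigma> g_continuous by (intro homeomorphismI) auto
  then show ?thesis using that by blast
qed

lemma complete_imp_isometric_to_plane: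
  assumes "connected (UNIV :: 'a set)" "complete_surface A f"
  shows "isometric_to_plane A f"
proof -
  obtain \<sigma> where \<sigma>: "homeomorphism UNIV UNIV g \<sigma>"
    using complete_imp_homeomorphism[OF assms] by blast
  have "smooth_on (g ` fst c) (snd c \<circ> \<sigma>)" if "c \<in> A" for c
    using section_smooth(2)[OF open_UNIV open_UNIV \<sigma> that] by simp
  then show ?thesis
    unfolding isometric_to_plane_def using \<sigma> g_smooth g_isometric by blast
qed

end

section \<open>Isotropic surfaces in Minkowski space\<close>

theorem theorem3p4:
  fixes A :: "'a::{t2_space, second_countable_topology} chart set"
    and f :: "'a \<Rightarrow> real^4"
  assumes "oriented_atlas A"
    and "connected (UNIV :: 'a set)"
    and "spacelike_immersion A f"
    and "plus_isotropic A f"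
  shows "(complete_surface A f \<longrightarrow> isometric_to_plane A f) \<and>
         (\<exists>\<Phi>. mink_isometry \<Phi> \<and>
            (\<forall>p. \<exists>U \<zeta> l. p \<in> U \<and> oriented_chart A (U, \<zeta>) \<and> smooth_on UNIV l \<and>
               (\<forall>q\<in>U. \<Phi> (f q) = i_lambda l (\<zeta> q))))"
proof -
  obtain \<Phi> g lam where \<Phi>: "mink_isometry \<Phi>"
    and \<Phi>f: "\<And>q. \<Phi> (f q) = vector [lam q, lam q, g q $ 1, g q $ 2]"
    and g: "\<And>c. c \<in> A \<Longrightarrow> smooth_on (chart_image c) (local_rep g c)"
    and lam: "\<And>c. c \<in> A \<Longrightarrow> smooth_on (chart_image c) (local_rep lam c)"
    and det: "\<And>c u. c \<in> A \<Longrightarrow> u \<in> chart_image c \<Longrightarrow> det (matrix (differential g c u)) > 0"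
    and iso: "\<And>c u v w. c \<in> A \<Longrightarrow> u \<in> chart_image c \<Longrightarrow>
       differential g c u v \<bullet> differential g c u w = induced_metric f c u v w"
    using isotropic_graph_form[OF assms] by metis
  interpret flat_development A f g
    using assms(1,3) g det iso by unfold_locales (auto simp: spacelike_immersion_def)
  have "\<exists>U \<zeta> l. p \<in> U \<and> oriented_chart A (U, \<zeta>) \<and> smooth_on UNIV l \<and>
      (\<forall>q\<in>U. \<Phi> (f q) = i_lambda l (\<zeta> q))" for p
  proof -
    obtain U l where "p \<in> U" "oriented_chart A (U, g)" "smooth_on UNIV l"
      and "\<And>q. q \<in> U \<Longrightarrow> l (g q) = lam q"
      using local_graph_chart[OF lam, of p] by metis
    then show ?thesis by (intro exI[of _ U] exI[of _ g] exI[of _ l]) (simp add: \<Phi>f i_lambda_def)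
  qed
  then show ?thesis using complete_imp_isometric_to_plane[OF assms(2)] \<Phi> by blast
qed

end
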